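(* Let $\Omega$ be a bounded domain in $\mathbb{R}^m$. Let $\vec F=(F_1,\dots,F_m) \in C^1(\bar\Omega)$ be a vector field and $H \in L^\infty(\Omega)$ a real function. Let $u, v \in C^2(\Omega)\cap C^0(\bar\Omega)\cap W^{1,1}(\Omega)$ be two minimizers for $\mathcal{F}_H(\cdot)$ in $W^{1,1}(\Omega)$ with $u = v$ on $\partial\Omega$. Suppose $m \ge \operatorname{rank}(h_{IJ}(p)) \ge 3$ for all $p\in\Omega$. Then $u = v$ in $\Omega$.
   Context: The generalized $p$-area is $\mathcal{F}_H(u) := \int_\Omega \{|\nabla u+\vec F| + Hu\}\,dx^1\wedge\cdots\wedge dx^m$ for $u\in W^{1,1}(\Omega)$. A function $u\in W^{1,1}(\Omega)$ is a minimizer for $\mathcal{F}_H$ in $W^{1,1}(\Omega)$ if $\mathcal{F}_H(u)\le \mathcal{F}_H(u+\varphi)$ for every $\varphi\in W_0^{1,1}(\Omega)$. $h_{IJ} := \partial_I F_J-\partial_J F_I$ for $1\le I,J\le m$, regarded as an $m\times m$ matrix. The integer $m$ need not be even. *)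

theory Defs
  imports "HOL-Analysis.Analysis"
begin

definition partial_deriv :: "'m::finite \<Rightarrow> (real^'m \<Rightarrow> 'b::real_normed_vector) \<Rightarrow> real^'m \<Rightarrow> 'b" where
  "partial_deriv i f x = frechet_derivative f (at x) (axis i 1)"

text \<open>The class \<open>C\<^sup>k\<close> on an open set \<open>S\<close>.\<close>

primrec Ck_on :: "nat \<Rightarrow> (real^'m::finite) set \<Rightarrow> (real^'m \<Rightarrow> 'b::real_normed_vector) \<Rightarrow> bool" where
  "Ck_on 0 S f \<longleftrightarrow> continuous_on S f"
| "Ck_on (Suc k) S f \<longleftrightarrow>
     (\<forall>x\<in>S. f differentiable (at x)) \<and> (\<forall>i. Ck_on k S (partial_deriv i f))"

text \<open>The class \<open>C\<^sup>1\<close> on the closure of an open set \<open>S\<close>, in the usual sense that the function and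
  its first partial derivatives on \<open>S\<close> extend continuously to the closure.\<close>

definition C1_closure :: "(real^'m::finite) set \<Rightarrow> (real^'m \<Rightarrow> 'b::real_normed_vector) \<Rightarrow> bool" where
  "C1_closure S f \<longleftrightarrow>
     Ck_on 1 S f \<and> continuous_on (closure S) f \<and>
     (\<forall>i. \<exists>g. continuous_on (closure S) g \<and> (\<forall>x\<in>S. g x = partial_deriv i f x))"

definition test_function :: "(real^'m::finite) set \<Rightarrow> (real^'m \<Rightarrow> real) \<Rightarrow> bool" where
  "test_function \<Omega> \<psi> \<longleftrightarrow>
     (\<forall>k. Ck_on k UNIV \<psi>) \<and>
     compact (closure {x. \<psi> x \<noteq> 0}) \<and> closure {x. \<psi> x \<noteq> 0} \<subseteq> \<Omega>"

definition has_L1_weak_gradient ::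
    "(real^'m::finite) set \<Rightarrow> (real^'m \<Rightarrow> real) \<Rightarrow> (real^'m \<Rightarrow> real^'m) \<Rightarrow> bool" where
  "has_L1_weak_gradient \<Omega> u g \<longleftrightarrow>
     set_integrable lebesgue \<Omega> g \<and>
     (\<forall>\<psi> i. test_function \<Omega> \<psi> \<longrightarrow>
        (LINT x:\<Omega>|lebesgue. u x * partial_deriv i \<psi> x) =
        - (LINT x:\<Omega>|lebesgue. g x $ i * \<psi> x))"

text \<open>Elements of Sobolev spaces are represented by functions on the whole space whose values
  outside \<open>\<Omega>\<close> are irrelevant; functions equal almost everywhere are not identified.\<close>

definition W11 :: "(real^'m::finite) set \<Rightarrow> (real^'m \<Rightarrow> real) set" where
  "W11 \<Omega> = {u. set_integrable lebesgue \<Omega> u \<and> (\<exists>g. has_L1_weak_gradient \<Omega> u g)}"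

text \<open>The weak gradient is determined only up to a null set; the choice of representative does
  not affect any of the integrals below.\<close>

definition weak_gradient :: "(real^'m::finite) set \<Rightarrow> (real^'m \<Rightarrow> real) \<Rightarrow> real^'m \<Rightarrow> real^'m" where
  "weak_gradient \<Omega> u = (SOME g. has_L1_weak_gradient \<Omega> u g)"

definition W11_norm :: "(real^'m::finite) set \<Rightarrow> (real^'m \<Rightarrow> real) \<Rightarrow> real" where
  "W11_norm \<Omega> u =
     (LINT x:\<Omega>|lebesgue. \<bar>u x\<bar>) + (LINT x:\<Omega>|lebesgue. norm (weak_gradient \<Omega> u x))"

text \<open>The closure of the test functions in the \<open>W\<^sup>1\<^sup>,\<^sup>1\<close> norm.\<close>

definition W11_0 :: "(real^'m::finite) set \<Rightarrow> (real^'m \<Rightarrow> real) set" where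
  "W11_0 \<Omega> = {\<phi> \<in> W11 \<Omega>. \<exists>\<psi> :: nat \<Rightarrow> real^'m \<Rightarrow> real.
     (\<forall>n. test_function \<Omega> (\<psi> n)) \<and>
     (\<lambda>n. W11_norm \<Omega> (\<lambda>x. \<phi> x - \<psi> n x)) \<longlonglongrightarrow> 0}"

definition L_infty :: "(real^'m::finite) set \<Rightarrow> (real^'m \<Rightarrow> real) set" where
  "L_infty \<Omega> = {H \<in> borel_measurable (lebesgue_on \<Omega>).
     \<exists>C. AE x in lebesgue_on \<Omega>. \<bar>H x\<bar> \<le> C}"

definition p_area :: "(real^'m::finite) set \<Rightarrow> (real^'m \<Rightarrow> real^'m) \<Rightarrow> (real^'m \<Rightarrow> real) \<Rightarrow>
    (real^'m \<Rightarrow> real) \<Rightarrow> real" where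
  "p_area \<Omega> F H u = (LINT x:\<Omega>|lebesgue. norm (weak_gradient \<Omega> u x + F x) + H x * u x)"

definition p_area_minimizer :: "(real^'m::finite) set \<Rightarrow> (real^'m \<Rightarrow> real^'m) \<Rightarrow>
    (real^'m \<Rightarrow> real) \<Rightarrow> (real^'m \<Rightarrow> real) \<Rightarrow> bool" where
  "p_area_minimizer \<Omega> F H u \<longleftrightarrow>
     u \<in> W11 \<Omega> \<and> (\<forall>\<phi>\<in>W11_0 \<Omega>. p_area \<Omega> F H u \<le> p_area \<Omega> F H (\<lambda>x. u x + \<phi> x))"

definition h_matrix :: "(real^'m::finite \<Rightarrow> real^'m) \<Rightarrow> real^'m \<Rightarrow> real^'m^'m" where
  "h_matrix F p = (\<chi> I J. partial_deriv I (\<lambda>x. F x $ J) p - partial_deriv J (\<lambda>x. F x $ I) p)"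

end

theory Submission imports Defs begin

text \<open>Let \<open>\<alpha> = \<nabla>u + F\<close> and \<open>\<beta> = \<nabla>v + F\<close>, and let \<open>w = v - u\<close>. The functional is convex, so averaging the two
  minimizers cannot lower it, and equality in the triangle inequality must hold almost everywhere: \<open>\<alpha>\<close> and \<open>\<beta>\<close> point in the same direction. Concretely, \<open>u\<close> is compared with
  \<open>u + \<phi>\<close> and \<open>v\<close> with \<open>v - \<phi>\<close>, where \<open>\<phi>\<close> is a truncation of \<open>w\<close> that has compact support in \<open>\<Omega>\<close>
  because \<open>w\<close> vanishes on the boundary. Both \<open>\<alpha>\<close> and \<open>\<beta>\<close> are continuous, so they are parallel at every
  point with \<open>w > 0\<close> (lemma \<open>minimizers_parallel\<close>).

  The rank condition then forces \<open>\<alpha> = \<beta>\<close>. Read as one-forms, \<open>\<alpha>\<close> and \<open>\<beta>\<close> differ from \<open>F\<close> by exact forms and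
  have the same exterior derivative \<open>h\<close>. Where \<open>\<beta>\<close> does not vanish, \<open>\<alpha> = l \<beta>\<close> for a differentiable
  function \<open>l\<close>, hence \<open>(1 - l) h = dl \<and> \<beta>\<close>. A wedge of two one-forms has rank at most two, so \<open>l = 1\<close>
  (lemma \<open>parallel_fields_agree\<close>). Exchanging the roles covers the points where only \<open>\<alpha>\<close> is nonzero, and
  where both vanish they agree trivially.

  Consequently \<open>\<nabla>w = 0\<close> wherever \<open>w > 0\<close>, the function \<open>(max w 0)\<^sup>2\<close> has zero derivative on the connected set
  \<open>\<Omega>\<close>, and its boundary values are zero. So \<open>v \<le> u\<close> (lemma \<open>minimizers_ordered\<close>), and the theorem follows
  by symmetry.

  Two facts link the weak formulation with classical derivatives. The weak gradient of a continuously
  differentiable function is its gradient almost everywhere, by the fundamental lemma of the calculus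
  of variations. Continuously differentiable functions with compact support in \<open>\<Omega>\<close> belong to
  \<open>W11_0 \<Omega>\<close>, by mollification. Both need enough smooth functions, which come from an explicit algebra
  generated by flat functions of the coordinates (\<open>smooth_alg\<close>).\<close>

section \<open>Partial derivatives and gradients\<close>

lemma partial_deriv_eq:
  assumes "(f has_derivative D) (at x)"
  shows "partial_deriv i f x = D (axis i 1)"
  unfolding partial_deriv_def using frechet_derivative_at[OF assms] by simp

definition grad :: "(real^'m::finite \<Rightarrow> real) \<Rightarrow> real^'m \<Rightarrow> real^'m" where
  "grad f x = (\<chi> i. partial_deriv i f x)"

lemma grad_nth [simp]: "grad f x $ i = partial_deriv i f x"
  by (simp add: grad_def)

lemma has_derivative_grad:
  assumes "f differentiable (at x)"
  shows "(f has_derivative (\<lambda>h. grad f x \<bullet> h)) (at x)"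
proof -
  let ?D = "frechet_derivative f (at x)"
  have D: "(f has_derivative ?D) (at x)"
    using assms frechet_derivative_works by blast
  then have lin: "linear ?D"
    by (simp add: has_derivative_linear)
  have "?D h = grad f x \<bullet> h" for h
  proof -
    have "?D h = ?D (\<Sum>i\<in>UNIV. (h $ i) *s axis i 1)"
      by (simp add: basis_expansion)
    also have "\<dots> = (\<Sum>i\<in>UNIV. h $ i * ?D (axis i 1))"
      by (simp add: linear_sum[OF lin] scalar_mult_eq_scaleR linear_cmul[OF lin])
    also have "\<dots> = grad f x \<bullet> h"
      by (simp add: inner_vec_def partial_deriv_def mult.commute)
    finally show ?thesis .
  qed
  then have "?D = (\<lambda>h. grad f x \<bullet> h)" by auto
  with D show ?thesis by simp
qed

lemma partial_deriv_const [simp]: "partial_deriv i (\<lambda>_. c) = (\<lambda>_. 0)"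
  by (rule ext) (simp add: partial_deriv_eq[OF has_derivative_const])

lemma partial_deriv_add:
  assumes "f differentiable (at x)" "g differentiable (at x)"
  shows "partial_deriv i (\<lambda>x. f x + g x) x = partial_deriv i f x + partial_deriv i g x"
  using assms unfolding frechet_derivative_works
  by (subst partial_deriv_eq[OF has_derivative_add]) (auto simp: partial_deriv_def)

lemma partial_deriv_diff:
  assumes "f differentiable (at x)" "g differentiable (at x)"
  shows "partial_deriv i (\<lambda>x. f x - g x) x = partial_deriv i f x - partial_deriv i g x"
  using assms unfolding frechet_derivative_works
  by (subst partial_deriv_eq[OF has_derivative_diff]) (auto simp: partial_deriv_def)

lemma partial_deriv_mult:
  fixes f g :: "real^'m::finite \<Rightarrow> real"
  assumes "f differentiable (at x)" "g differentiable (at x)"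
  shows "partial_deriv i (\<lambda>x. f x * g x) x = f x * partial_deriv i g x + partial_deriv i f x * g x"
  using assms unfolding frechet_derivative_works
  by (subst partial_deriv_eq[OF has_derivative_mult]) (auto simp: partial_deriv_def)

lemma has_derivative_field_compose:
  fixes f :: "real^'m::finite \<Rightarrow> real"
  assumes "(f has_derivative D) (at x)" "(g has_real_derivative g') (at (f x))"
  shows "((\<lambda>x. g (f x)) has_derivative (\<lambda>h. g' * D h)) (at x)"
  using has_derivative_compose[OF assms(1) assms(2)[unfolded has_field_derivative_def]] .

lemma partial_deriv_compose:
  fixes f :: "real^'m::finite \<Rightarrow> real"
  assumes "f differentiable (at x)" "(g has_real_derivative g') (at (f x))"
  shows "partial_deriv i (\<lambda>x. g (f x)) x = g' * partial_deriv i f x"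
  using partial_deriv_eq[OF has_derivative_field_compose[OF has_derivative_grad[OF assms(1)] assms(2)]]
  by (simp add: inner_axis)

lemma partial_deriv_cong_open:
  assumes "open S" "x \<in> S" "\<And>y. y \<in> S \<Longrightarrow> f y = g y" "g differentiable (at x)"
  shows "f differentiable (at x)" "partial_deriv i f x = partial_deriv i g x"
proof -
  have "(f has_derivative frechet_derivative g (at x)) (at x)"
    using assms frechet_derivative_works
    by (metis has_derivative_transform_within_open)
  then show "f differentiable (at x)" "partial_deriv i f x = partial_deriv i g x"
    using partial_deriv_eq[of f _ x i] by (auto simp: differentiable_def partial_deriv_def[of i g])
qed

lemma Ck_on_1_iff:
  "Ck_on 1 S f \<longleftrightarrow> (\<forall>x\<in>S. f differentiable (at x)) \<and> (\<forall>i. continuous_on S (partial_deriv i f))"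
  unfolding One_nat_def by simp

lemma Ck_on_1D:
  assumes "Ck_on 1 S f"
  shows "x \<in> S \<Longrightarrow> f differentiable (at x)" "continuous_on S (partial_deriv i f)" "continuous_on S f"
  using assms unfolding Ck_on_1_iff
  by (auto intro!: continuous_at_imp_continuous_on differentiable_imp_continuous_within)

lemma Ck_on_1_continuous_grad: "Ck_on 1 S f \<Longrightarrow> continuous_on S (grad f)"
  unfolding grad_def by (intro continuous_on_vec_lambda Ck_on_1D)

lemma Ck_on_Suc_imp: "Ck_on (Suc k) S f \<Longrightarrow> Ck_on k S f"
proof (induction k arbitrary: f)
  case 0
  then show ?case using Ck_on_1D(3)[of S f] by (simp add: Ck_on_1_iff)
qed auto

lemma Ck_on_2_imp_1: "Ck_on 2 S f \<Longrightarrow> Ck_on 1 S f"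
  using Ck_on_Suc_imp[of 1 S f] by (simp add: numeral_2_eq_2)

lemma Ck_on_1_mono: "Ck_on 1 S f \<Longrightarrow> T \<subseteq> S \<Longrightarrow> Ck_on 1 T f"
  unfolding Ck_on_1_iff by (auto intro: continuous_on_subset)

lemma Ck_on_1_add:
  assumes "Ck_on 1 S f" "Ck_on 1 S g"
  shows "Ck_on 1 S (\<lambda>x. f x + g x)"
proof -
  have "continuous_on S (partial_deriv i (\<lambda>x. f x + g x))" for i
    using Ck_on_1D[OF assms(1)] Ck_on_1D[OF assms(2)]
    by (subst continuous_on_cong[OF refl partial_deriv_add]) (auto intro!: continuous_intros)
  then show ?thesis using assms unfolding Ck_on_1_iff by (auto intro: differentiable_add)
qed

lemma Ck_on_1_diff:
  assumes "Ck_on 1 S f" "Ck_on 1 S g"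
  shows "Ck_on 1 S (\<lambda>x. f x - g x)"
proof -
  have "continuous_on S (partial_deriv i (\<lambda>x. f x - g x))" for i
    using Ck_on_1D[OF assms(1)] Ck_on_1D[OF assms(2)]
    by (subst continuous_on_cong[OF refl partial_deriv_diff]) (auto intro!: continuous_intros)
  then show ?thesis using assms unfolding Ck_on_1_iff by (auto intro: differentiable_diff)
qed

lemma Ck_on_1_mult:
  fixes f g :: "real^'m::finite \<Rightarrow> real"
  assumes "Ck_on 1 S f" "Ck_on 1 S g"
  shows "Ck_on 1 S (\<lambda>x. f x * g x)"
proof -
  have "continuous_on S (partial_deriv i (\<lambda>x. f x * g x))" for i
    using Ck_on_1D[OF assms(1)] Ck_on_1D[OF assms(2)]
    by (subst continuous_on_cong[OF refl partial_deriv_mult]) (auto intro!: continuous_intros)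
  then show ?thesis using assms unfolding Ck_on_1_iff by (auto intro: differentiable_mult)
qed

section \<open>Smooth functions built from flat functions\<close>

text \<open>For \<open>k = 0\<close> the classical smooth function that is flat at the origin. The powers in the denominator make
  the family closed under differentiation up to linear combinations.\<close>

definition flat :: "nat \<Rightarrow> real \<Rightarrow> real" where
  "flat k t = (if t > 0 then exp (- 1 / t) / t ^ k else 0)"

lemma flat_tendsto_0: "(flat k \<longlongrightarrow> 0) (at 0)"
proof (rule filterlim_split_at)
  have "eventually (\<lambda>t::real. t > 0) (at_right 0)" "eventually (\<lambda>t::real. t < 0) (at_left 0)"
    by (auto simp: eventually_at_filter)
  note ev = this
  have "((\<lambda>t::real. exp (- 1 / t) / t ^ k) \<longlongrightarrow> 0) (at_right 0)"
    using filterlim_compose[OF tendsto_power_div_exp_0[of k] filterlim_inverse_at_top_right]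
    by (simp add: divide_inverse exp_minus power_inverse mult.commute)
  then show "(flat k \<longlongrightarrow> 0) (at_right 0)"
    by (rule Lim_transform_eventually) (use ev(1) in eventually_elim, auto simp: flat_def)
  show "(flat k \<longlongrightarrow> 0) (at_left 0)"
    by (rule Lim_transform_eventually[OF tendsto_const])
       (use ev(2) in eventually_elim, auto simp: flat_def)
qed

lemma DERIV_flat: "(flat k has_real_derivative flat (k + 2) t - k * flat (k + 1) t) (at t)"
proof -
  consider "t > 0" | "t < 0" | "t = 0" by linarith
  then show ?thesis
  proof cases
    case 1
    have "((\<lambda>t. exp (- 1 / t) / t ^ k) has_real_derivative
            flat (k + 2) t - k * flat (k + 1) t) (at t)"
    proof -
      have "real k * t ^ (k - 1) = k * t ^ k / t"
        using 1 by (cases k) auto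
      then have pow: "((\<lambda>t. t ^ k) has_real_derivative k * t ^ k / t) (at t)"
        using DERIV_pow[of k t UNIV] by simp
      have e: "((\<lambda>t. exp (- 1 / t)) has_real_derivative exp (- 1 / t) / t\<^sup>2) (at t)"
        using 1 by (auto intro!: derivative_eq_intros simp: field_simps power2_eq_square)
      show ?thesis
        by (rule DERIV_cong[OF DERIV_divide[OF e pow]])
           (use 1 in \<open>auto simp: flat_def field_simps power2_eq_square\<close>)
    qed
    then show ?thesis
      by (rule has_field_derivative_transform_within_open[of _ _ _ "{0<..}"])
         (use 1 in \<open>auto simp: flat_def\<close>)
  next
    case 2
    have "((\<lambda>t. 0) has_real_derivative flat (k + 2) t - k * flat (k + 1) t) (at t)"
      using 2 by (auto simp: flat_def)
    then show ?thesis
      by (rule has_field_derivative_transform_within_open[of _ _ _ "{..<0}"])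
         (use 2 in \<open>auto simp: flat_def\<close>)
  next
    case 3
    have "(\<lambda>h. (flat k (0 + h) - flat k 0) / h) = flat (Suc k)"
      by (auto simp: flat_def)
    then show ?thesis
      using flat_tendsto_0[of "Suc k"] 3 by (simp add: DERIV_def flat_def)
  qed
qed

text \<open>An algebra of functions, closed under partial differentiation, from which all test functions are
  obtained, either as members or by convolution with a member. Closure under \<open>exp\<close> provides \<open>1 - exp (- n \<eta>)\<close>, which approximates the indicator of the
  set where \<open>\<eta> > 0\<close>.\<close>

inductive_set smooth_alg :: "(real^'m::finite \<Rightarrow> real) set" where
  const: "(\<lambda>_. c) \<in> smooth_alg"
| flat: "(\<lambda>x. flat k (s * x $ i + c)) \<in> smooth_alg"
| add: "f \<in> smooth_alg \<Longrightarrow> g \<in> smooth_alg \<Longrightarrow> (\<lambda>x. f x + g x) \<in> smooth_alg"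
| mult: "f \<in> smooth_alg \<Longrightarrow> g \<in> smooth_alg \<Longrightarrow> (\<lambda>x. f x * g x) \<in> smooth_alg"
| exp: "f \<in> smooth_alg \<Longrightarrow> (\<lambda>x. exp (f x)) \<in> smooth_alg"

lemma smooth_alg_closed:
  "f \<in> smooth_alg \<Longrightarrow> (\<forall>x. f differentiable (at x)) \<and> (\<forall>j. partial_deriv j f \<in> smooth_alg)"
proof (induction rule: smooth_alg.induct)
  case (const c)
  then show ?case by (auto intro: smooth_alg.const)
next
  case (flat k s i c)
  have D: "((\<lambda>x. s * x $ i + c) has_derivative (\<lambda>h. s * h $ i)) (at x)" for x :: "real^'a"
    using bounded_linear.has_derivative[OF bounded_linear_vec_nth has_derivative_ident]
    by (auto intro!: derivative_eq_intros)
  have *: "((\<lambda>x. flat k (s * x $ i + c)) has_derivative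
      (\<lambda>h. (flat (k + 2) (s * x $ i + c) - k * flat (k + 1) (s * x $ i + c)) * (s * h $ i))) (at x)"
    for x :: "real^'a"
    using has_derivative_field_compose[OF D DERIV_flat] .
  have "partial_deriv j (\<lambda>x. flat k (s * x $ i + c)) =
     (\<lambda>x. (flat (k + 2) (s * x $ i + c) + (- real k) * flat (k + 1) (s * x $ i + c)) * (s * axis j 1 $ i))" for j
    by (rule ext) (simp add: partial_deriv_eq[OF *])
  moreover have "\<dots> j \<in> smooth_alg" for j
    by (intro smooth_alg.intros)
  ultimately show ?case
    using * by (auto simp: differentiable_def)
next
  case (add f g)
  then have "partial_deriv j (\<lambda>x. f x + g x) = (\<lambda>x. partial_deriv j f x + partial_deriv j g x)" for j
    by (auto simp: partial_deriv_add)
  with add show ?case by (auto intro: smooth_alg.add differentiable_add)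
next
  case (mult f g)
  then have "partial_deriv j (\<lambda>x. f x * g x) = (\<lambda>x. f x * partial_deriv j g x + partial_deriv j f x * g x)" for j
    by (auto simp: partial_deriv_mult)
  with mult show ?case by (auto intro!: smooth_alg.add smooth_alg.mult differentiable_mult)
next
  case (exp f)
  then have "partial_deriv j (\<lambda>x. exp (f x)) = (\<lambda>x. exp (f x) * partial_deriv j f x)" for j
    by (intro ext partial_deriv_compose) (auto intro!: derivative_eq_intros)
  moreover have "(\<lambda>x. exp (f x)) differentiable (at x)" for x
    using exp has_derivative_exp[of f _ x UNIV] unfolding differentiable_def by blast
  ultimately show ?case using exp by (auto intro!: smooth_alg.exp smooth_alg.mult)
qed

text \<open>Every derivative of a member is again a member, and members are differentiable, hence
  continuous; so every order of differentiability is reached by induction.\<close>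

lemma smooth_alg_Ck_on: "f \<in> smooth_alg \<Longrightarrow> Ck_on k UNIV f"
proof (induction k arbitrary: f)
  case 0
  then show ?case
    using smooth_alg_closed[OF 0]
    by (auto intro!: continuous_at_imp_continuous_on differentiable_imp_continuous_within)
qed (use smooth_alg_closed in auto)

lemma smooth_alg_prod:
  "finite I \<Longrightarrow> (\<And>i. i \<in> I \<Longrightarrow> f i \<in> smooth_alg) \<Longrightarrow> (\<lambda>x. \<Prod>i\<in>I. f i x) \<in> smooth_alg"
  by (induction I rule: finite_induct) (auto intro: smooth_alg.intros)

text \<open>The factors are written as \<open>flat k (s * x $ i + c)\<close>, the shape of the generators of \<open>smooth_alg\<close>.\<close>

definition box_bump :: "real^'m::finite \<Rightarrow> real^'m \<Rightarrow> real^'m \<Rightarrow> real" where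
  "box_bump a b x = (\<Prod>i\<in>UNIV. flat 0 (1 * x $ i + (- a $ i)) * flat 0 ((-1) * x $ i + b $ i))"

lemma box_bump_smooth: "box_bump a b \<in> smooth_alg"
  unfolding box_bump_def[abs_def] by (intro smooth_alg_prod smooth_alg.intros finite)

lemma flat_nonneg: "0 \<le> flat k t"
  by (simp add: flat_def)

lemma box_bump_nonneg: "0 \<le> box_bump a b x"
  unfolding box_bump_def by (intro prod_nonneg mult_nonneg_nonneg ballI flat_nonneg)

lemma box_bump_eq_0_iff: "box_bump a b x = 0 \<longleftrightarrow> x \<notin> box a b"
  proof -
  have "flat 0 t = 0 \<longleftrightarrow> t \<le> 0" for t
    by (simp add: flat_def)
  then show ?thesis
    unfolding box_bump_def by (simp add: mem_box_cart) (meson not_less)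
qed

section \<open>Integrals of compactly supported functions\<close>

lemma integral_cont_compact_support:
  fixes f :: "real^'m::finite \<Rightarrow> real"
  assumes "continuous_on UNIV f" "\<And>x. x \<notin> cbox a b \<Longrightarrow> f x = 0"
  shows "integrable lebesgue f" "integral\<^sup>L lebesgue f = integral (cbox a b) f"
proof -
  have "set_integrable lebesgue (cbox a b) f"
    by (rule absolutely_integrable_continuous) (use assms continuous_on_subset in blast)
  moreover have "(\<lambda>x. indicator (cbox a b) x *\<^sub>R f x) = f"
    using assms(2) by (fastforce simp: indicator_def)
  ultimately show "integrable lebesgue f" "integral\<^sup>L lebesgue f = integral (cbox a b) f"
    using set_lebesgue_integral_eq_integral(2)[of "cbox a b" f]
    by (auto simp: set_integrable_def set_lebesgue_integral_def)
qed

lemma integral_lebesgue_affine: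
  fixes f :: "real^'m::finite \<Rightarrow> real"
  assumes "continuous_on UNIV f" "\<bar>c\<bar> = 1"
  shows "(LINT x|lebesgue. f (t + c *\<^sub>R x)) = integral\<^sup>L lebesgue f"
proof -
  have [measurable]: "f \<in> borel_measurable borel"
    using assms(1) by (rule borel_measurable_continuous_onI)
  have "c \<noteq> 0" using assms by auto
  have "integral\<^sup>L lborel f = integral\<^sup>L (density (distr lborel borel (\<lambda>x. t + c *\<^sub>R x)) (\<lambda>_. \<bar>c\<bar>^DIM(real^'m))) f"
    by (rule arg_cong[where f = "\<lambda>M. integral\<^sup>L M f", OF lborel_affine[OF \<open>c \<noteq> 0\<close>, of t]])
  also have "\<dots> = (LINT x|lborel. f (t + c *\<^sub>R x))"
    using assms(2) by (simp add: density_1 integral_distr)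
  finally show ?thesis by (simp add: integral_completion)
qed

text \<open>By translation invariance the integral of \<open>p (x + t e)\<close> does not depend on \<open>t\<close>, and its derivative in
  \<open>t\<close> at \<open>0\<close> is the integral of the partial derivative. This is the only source of integration by
  parts below.\<close>

lemma integral_partial_deriv_eq_0:
  fixes p :: "real^'m::finite \<Rightarrow> real"
  assumes "Ck_on 1 UNIV p" and supp: "\<And>x. x \<notin> cbox a b \<Longrightarrow> p x = 0"
  shows "integral\<^sup>L lebesgue (partial_deriv i p) = 0"
proof -
  define e :: "real^'m" where "e = axis i 1"
  \<comment> \<open>The box is enlarged by one in each direction, so that it contains the support of
    all translates by \<open>t e\<close> with \<open>\<bar>t\<bar> \<le> 1\<close>.\<close>
  define a' b' where "a' = a - 1" and "b' = b + 1"
  define G where "G t = integral (cbox a' b') (\<lambda>x. p (x + t *\<^sub>R e))" for t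
  note C1 = Ck_on_1D[OF assms(1)]
  have cp: "continuous_on UNIV p" by (rule C1(3))
  have comp: "continuous_on S (\<lambda>x. p (f x))" if "continuous_on S f" for S :: "'z::topological_space set" and f
    using continuous_on_compose2[OF cp that] by simp
  have compd: "continuous_on S (\<lambda>x. partial_deriv i p (f x))" if "continuous_on S f" for S :: "'z::topological_space set" and f
    using continuous_on_compose2[OF C1(2) that] by simp
  have outside: "x + t *\<^sub>R e \<notin> cbox a b" if "\<bar>t\<bar> \<le> 1" "x \<notin> cbox a' b'" for x t
  proof
    assume *: "x + t *\<^sub>R e \<in> cbox a b"
    have "x \<in> cbox a' b'"
      unfolding mem_box_cart
    proof
      fix j
      have "a $ j \<le> x $ j + t * e $ j" "x $ j + t * e $ j \<le> b $ j"
        using * by (auto simp: mem_box_cart)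
      moreover have "\<bar>t * e $ j\<bar> \<le> 1"
        using that(1) by (auto simp: e_def axis_def)
      ultimately show "a' $ j \<le> x $ j \<and> x $ j \<le> b' $ j"
        by (auto simp: a'_def b'_def)
    qed
    with that show False by simp
  qed
  have G: "G t = integral\<^sup>L lebesgue p" if "\<bar>t\<bar> \<le> 1" for t
  proof -
    have "G t = (LINT x|lebesgue. p (x + t *\<^sub>R e))"
      unfolding G_def
      by (rule integral_cont_compact_support(2)[symmetric])
         (use outside[OF that] supp in \<open>auto intro!: comp continuous_intros\<close>)
    also have "\<dots> = integral\<^sup>L lebesgue p"
      using integral_lebesgue_affine[OF cp, of 1 "t *\<^sub>R e"] by (simp add: add.commute)
    finally show ?thesis .
  qed
  have D: "((\<lambda>t. p (x + t *\<^sub>R e)) has_real_derivative partial_deriv i p (x + t *\<^sub>R e)) (at t within U)" for x t U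
  proof -
    have "((\<lambda>t. x + t *\<^sub>R e) has_derivative (\<lambda>h. h *\<^sub>R e)) (at t within U)"
      by (auto intro!: derivative_eq_intros)
    from has_derivative_compose[OF this has_derivative_grad[OF C1(1)]]
    show ?thesis
      by (simp add: has_field_derivative_def e_def inner_axis mult.commute[of _ "partial_deriv _ _ _"])
  qed
  have "(G has_real_derivative integral (cbox a' b') (\<lambda>x. partial_deriv i p (x + 0 *\<^sub>R e))) (at 0 within {-1..1})"
    unfolding G_def
    by (rule leibniz_rule_field_derivative[where fx = "\<lambda>t x. partial_deriv i p (x + t *\<^sub>R e)"])
       (auto intro!: D integrable_continuous comp compd continuous_intros simp: split_beta)
  then have "(G has_real_derivative integral (cbox a' b') (partial_deriv i p)) (at 0)"
    by (simp add: at_within_interior[of 0 "{-1..1::real}"])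
  moreover have "(G has_real_derivative 0) (at 0)"
    by (rule has_field_derivative_transform_within_open[OF DERIV_const, of "{-1<..<1}"])
       (auto simp: G)
  ultimately have "integral (cbox a' b') (partial_deriv i p) = 0"
    by (rule DERIV_unique)
  moreover have "partial_deriv i p x = 0" if "x \<notin> cbox a' b'" for x
  proof -
    have "x \<notin> cbox a b" using outside[of 0] that by auto
    then have "partial_deriv i p x = partial_deriv i (\<lambda>_. 0) x"
      by (intro partial_deriv_cong_open(2)[of "- cbox a b"]) (auto simp: supp)
    then show ?thesis by simp
  qed
  ultimately show ?thesis
    using integral_cont_compact_support(2)[OF C1(2), of a' b' i] by simp
qed

section \<open>Mollification\<close>

text \<open>The convolution of \<open>f\<close> and \<open>\<rho>\<close>, for \<open>f\<close> supported in the box. Integrating over a fixed box makes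
  differentiation under the integral sign available for integrands that are merely continuous.\<close>

definition conv :: "real^'m::finite \<Rightarrow> real^'m \<Rightarrow> (real^'m \<Rightarrow> real) \<Rightarrow> (real^'m \<Rightarrow> real) \<Rightarrow> real^'m \<Rightarrow> real" where
  "conv a b f \<rho> x = integral (cbox a b) (\<lambda>y. f y * \<rho> (x - y))"

lemma conv_derivative:
  fixes f \<rho> :: "real^'m::finite \<Rightarrow> real"
  assumes f: "continuous_on (cbox a b) f" and \<rho>: "Ck_on 1 UNIV \<rho>"
  shows "conv a b f \<rho> differentiable (at x)"
    and "partial_deriv i (conv a b f \<rho>) x = conv a b f (partial_deriv i \<rho>) x"
proof -
  define fx where "fx x y = f y *\<^sub>R blinfun_inner_right (grad \<rho> (x - y))" for x y
  note C1 = Ck_on_1D[OF \<rho>]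
  have comp: "continuous_on S (\<lambda>x. \<rho> (g x))" if "continuous_on S g" for S :: "'z::topological_space set" and g
    using continuous_on_compose2[OF C1(3) that] by simp
  have compd: "continuous_on S (\<lambda>x. grad \<rho> (g x))" if "continuous_on S g" for S :: "'z::topological_space set" and g
    using continuous_on_compose2[OF Ck_on_1_continuous_grad[OF \<rho>] that] by simp
  have compf: "continuous_on S (\<lambda>x. f (g x))" if "continuous_on S g" "g ` S \<subseteq> cbox a b" for S :: "'z::topological_space set" and g
    using continuous_on_compose2[OF f that] .
  have D: "((\<lambda>x. f y * \<rho> (x - y)) has_derivative blinfun_apply (fx x y)) (at x within UNIV)" for x y
  proof -
    have "((\<lambda>x. x - y) has_derivative (\<lambda>h. h)) (at x)"
      by (auto intro!: derivative_eq_intros)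
    then have "((\<lambda>x. \<rho> (x - y)) has_derivative (\<lambda>h. grad \<rho> (x - y) \<bullet> h)) (at x)"
      by (rule has_derivative_compose[OF _ has_derivative_grad[OF C1(1)[OF UNIV_I]]])
    from has_derivative_mult_right[OF this, of "f y"]
    show ?thesis by (simp add: fx_def scaleR_blinfun.rep_eq)
  qed
  have cfx: "continuous_on (UNIV \<times> cbox a b) (\<lambda>(x, y). fx x y)"
    unfolding fx_def split_beta
    by (intro continuous_on_scaleR compf bounded_linear.continuous_on[OF bounded_linear_blinfun_inner_right] compd)
       (auto intro!: continuous_intros)
  have *: "(conv a b f \<rho> has_derivative blinfun_apply (integral (cbox a b) (fx x))) (at x)"
    unfolding conv_def[abs_def]
  proof (rule leibniz_rule[where U = UNIV and f = "\<lambda>x y. f y * \<rho> (x - y)" and fx = fx])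
    show "(\<lambda>y. f y * \<rho> (x - y)) integrable_on cbox a b" for x
      by (intro integrable_continuous continuous_intros comp f)
  qed (use D cfx in auto)
  then show "conv a b f \<rho> differentiable (at x)"
    by (auto simp: differentiable_def)
  have "fx x integrable_on cbox a b"
    unfolding fx_def[abs_def]
    by (intro integrable_continuous f continuous_intros bounded_linear.continuous_on[OF bounded_linear_blinfun_inner_right] compd)
  then show "partial_deriv i (conv a b f \<rho>) x = conv a b f (partial_deriv i \<rho>) x"
    by (simp add: partial_deriv_eq[OF *] blinfun_apply_integral conv_def)
       (simp add: fx_def scaleR_blinfun.rep_eq inner_axis)
qed

text \<open>All derivatives fall on the kernel, whose derivatives of every order lie in \<open>smooth_alg\<close>.\<close>

lemma conv_Ck_on:
  fixes f \<rho> :: "real^'m::finite \<Rightarrow> real"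
  assumes f: "continuous_on (cbox a b) f"
  shows "\<rho> \<in> smooth_alg \<Longrightarrow> Ck_on k UNIV (conv a b f \<rho>)"
proof (induction k arbitrary: \<rho>)
  case 0
  show ?case
    using conv_derivative(1)[OF f smooth_alg_Ck_on[OF 0]]
    by (auto intro!: continuous_at_imp_continuous_on differentiable_imp_continuous_within)
next
  case (Suc k)
  have "partial_deriv i (conv a b f \<rho>) = conv a b f (partial_deriv i \<rho>)" for i
    using conv_derivative(2)[OF f smooth_alg_Ck_on[OF Suc.prems]] by blast
  then show ?case
    using Suc smooth_alg_closed[OF Suc.prems] conv_derivative(1)[OF f smooth_alg_Ck_on[OF Suc.prems]]
    by auto
qed

lemma uniformly_continuous_compact_support:
  fixes f :: "real^'m::finite \<Rightarrow> 'b::real_normed_vector"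
  assumes f: "continuous_on UNIV f" and supp: "\<And>x. x \<notin> cbox a b \<Longrightarrow> f x = 0" and "e > 0"
  shows "\<exists>d>0. \<forall>x y. norm (x - y) < d \<longrightarrow> norm (f x - f y) \<le> e"
proof -
  obtain R where "\<forall>x\<in>cbox a b. norm x \<le> R"
    using bounded_cbox[of a b] unfolding bounded_iff by blast
  then have R: "cbox a b \<subseteq> cball 0 R" by auto
  have "uniformly_continuous_on (cball 0 (R + 1)) f"
    by (rule compact_uniformly_continuous[OF continuous_on_subset[OF f]]) simp_all
  then obtain d where d: "d > 0"
    "\<forall>y\<in>cball 0 (R + 1). \<forall>x\<in>cball 0 (R + 1). dist x y < d \<longrightarrow> dist (f x) (f y) < e"
    using \<open>e > 0\<close> unfolding uniformly_continuous_on_def by metis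
  have "norm (f x - f y) \<le> e" if xy: "norm (x - y) < min d 1" for x y
  proof (cases "x \<in> cball 0 (R + 1) \<and> y \<in> cball 0 (R + 1)")
    case True
    then have "dist (f x) (f y) < e"
      using d(2) xy by (simp add: dist_norm)
    then show ?thesis by (simp add: dist_norm)
  next
    case False
    have "\<bar>norm x - norm y\<bar> < 1"
      using xy norm_triangle_ineq3[of x y] by linarith
    moreover have "R + 1 < norm x \<or> R + 1 < norm y"
      using False by (auto simp: not_le)
    ultimately have "x \<notin> cball 0 R" "y \<notin> cball 0 R"
      unfolding mem_cball_0 by linarith+
    then have "x \<notin> cbox a b" "y \<notin> cbox a b" using R by blast+
    then show ?thesis using \<open>e > 0\<close> by (simp add: supp)
  qed
  moreover have "0 < min d 1" using d(1) by simp
  ultimately show ?thesis by blast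
qed

text \<open>The kernel has total mass one, so the difference is the integral of \<open>(f y - f x) \<rho> (x - y)\<close>, a weighted
  mean of oscillations of \<open>f\<close> at the scale of the support of \<open>\<rho>\<close>.\<close>

lemma conv_close:
  fixes f \<rho> :: "real^'m::finite \<Rightarrow> real"
  assumes f: "continuous_on UNIV f" "\<And>x. x \<notin> cbox a b \<Longrightarrow> f x = 0"
    and \<rho>: "continuous_on UNIV \<rho>" "\<And>x. x \<notin> cbox r s \<Longrightarrow> \<rho> x = 0" "\<And>x. \<rho> x \<ge> 0" "integral\<^sup>L lebesgue \<rho> = 1"
    and close: "\<And>x y. \<rho> (x - y) \<noteq> 0 \<Longrightarrow> \<bar>f y - f x\<bar> \<le> e"
  shows "\<bar>conv a b f \<rho> x - f x\<bar> \<le> e"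
proof -
  have c\<rho>: "continuous_on UNIV (\<lambda>y. \<rho> (x - y))"
    by (rule continuous_on_compose2[OF \<rho>(1)]) (auto intro!: continuous_intros)
  have supp\<rho>: "\<rho> (x - y) = 0" if "y \<notin> cbox (x - s) (x - r)" for y
  proof (rule \<rho>(2))
    show "x - y \<notin> cbox r s"
      using that unfolding mem_box_cart by (auto simp: algebra_simps)
  qed
  have int\<rho>: "integrable lebesgue (\<lambda>y. \<rho> (x - y))" "(LINT y|lebesgue. \<rho> (x - y)) = 1"
    using integral_cont_compact_support[OF c\<rho> supp\<rho>] integral_lebesgue_affine[OF \<rho>(1), of "-1" x] \<rho>(4)
    by auto
  have int1: "integrable lebesgue (\<lambda>y. f y * \<rho> (x - y))"
    "conv a b f \<rho> x = (LINT y|lebesgue. f y * \<rho> (x - y))"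
    using integral_cont_compact_support[of "\<lambda>y. f y * \<rho> (x - y)" a b, OF continuous_on_mult[OF f(1) c\<rho>]]
    by (simp_all add: conv_def f(2))
  have "conv a b f \<rho> x - f x = (LINT y|lebesgue. f y * \<rho> (x - y)) - f x * (LINT y|lebesgue. \<rho> (x - y))"
    by (simp add: int1 int\<rho>)
  also have "\<dots> = (LINT y|lebesgue. f y * \<rho> (x - y) - f x * \<rho> (x - y))"
    using int1 int\<rho> by simp
  also have "\<bar>\<dots>\<bar> \<le> (LINT y|lebesgue. \<bar>f y * \<rho> (x - y) - f x * \<rho> (x - y)\<bar>)"
    using integral_norm_bound[of lebesgue "\<lambda>y. f y * \<rho> (x - y) - f x * \<rho> (x - y)"] by simp
  also have "\<dots> \<le> (LINT y|lebesgue. e * \<rho> (x - y))"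
  proof (rule integral_mono)
    show "integrable lebesgue (\<lambda>y. \<bar>f y * \<rho> (x - y) - f x * \<rho> (x - y)\<bar>)"
      using int1 int\<rho> by simp
    show "integrable lebesgue (\<lambda>y. e * \<rho> (x - y))" using int\<rho> by simp
    fix y
    have "\<bar>f y * \<rho> (x - y) - f x * \<rho> (x - y)\<bar> = \<bar>f y - f x\<bar> * \<rho> (x - y)"
      using \<rho>(3)[of "x - y"] by (simp add: abs_mult flip: left_diff_distrib)
    also have "\<dots> \<le> e * \<rho> (x - y)"
      using close[of x y] \<rho>(3)[of "x - y"] by (cases "\<rho> (x - y) = 0") (auto intro: mult_right_mono)
    finally show "\<bar>f y * \<rho> (x - y) - f x * \<rho> (x - y)\<bar> \<le> e * \<rho> (x - y)" .
  qed
  also have "\<dots> = e" using int\<rho> by simp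
  finally show ?thesis .
qed

lemma partial_deriv_zero_outside:
  fixes f :: "real^'m::finite \<Rightarrow> 'b::real_normed_vector"
  assumes "closed K" "\<And>y. y \<notin> K \<Longrightarrow> f y = 0" "x \<notin> K"
  shows "partial_deriv i f x = 0"
proof -
  have "partial_deriv i f x = partial_deriv i (\<lambda>_. 0) x"
    by (rule partial_deriv_cong_open(2)[of "- K"]) (use assms in auto)
  then show ?thesis by simp
qed

lemma reflect_derivative:
  fixes \<rho> :: "real^'m::finite \<Rightarrow> real"
  assumes "Ck_on 1 UNIV \<rho>"
  shows "Ck_on 1 UNIV (\<lambda>y. \<rho> (x - y))"
    and "partial_deriv i (\<lambda>y. \<rho> (x - y)) y = - partial_deriv i \<rho> (x - y)"
proof -
  note C1 = Ck_on_1D[OF assms]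
  have D: "((\<lambda>y. \<rho> (x - y)) has_derivative (\<lambda>h. grad \<rho> (x - y) \<bullet> (- h))) (at y)" for y
  proof -
    have "((\<lambda>y. x - y) has_derivative (\<lambda>h. - h)) (at y)"
      by (auto intro!: derivative_eq_intros)
    then show ?thesis
      by (rule has_derivative_compose[OF _ has_derivative_grad[OF C1(1)[OF UNIV_I]]])
  qed
  have pd: "partial_deriv i (\<lambda>y. \<rho> (x - y)) y = - partial_deriv i \<rho> (x - y)" for i y
    by (simp add: partial_deriv_eq[OF D] inner_axis)
  then show "partial_deriv i (\<lambda>y. \<rho> (x - y)) y = - partial_deriv i \<rho> (x - y)" .
  have "continuous_on UNIV (\<lambda>y. - partial_deriv i \<rho> (x - y))" for i
    by (rule continuous_on_minus, rule continuous_on_compose2[OF C1(2)])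
       (auto intro!: continuous_intros)
  moreover have "(\<lambda>y. \<rho> (x - y)) differentiable (at y)" for y
    using D differentiable_def by blast
  ultimately show "Ck_on 1 UNIV (\<lambda>y. \<rho> (x - y))"
    unfolding Ck_on_1_iff pd[abs_def] by blast
qed

text \<open>The two sides differ by the integral of the partial derivative of \<open>\<lambda>y. f y * \<rho> (x - y)\<close>. Moving the
  derivative from the kernel to \<open>f\<close> is what makes mollification converge together with its gradient.\<close>

lemma conv_partial_swap:
  fixes f \<rho> :: "real^'m::finite \<Rightarrow> real"
  assumes f: "Ck_on 1 UNIV f" "\<And>x. x \<notin> cbox a b \<Longrightarrow> f x = 0" and \<rho>: "Ck_on 1 UNIV \<rho>"
  shows "conv a b f (partial_deriv i \<rho>) x = conv a b (partial_deriv i f) \<rho> x"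
proof -
  let ?p = "\<lambda>y. f y * \<rho> (x - y)"
  note R = reflect_derivative[OF \<rho>, where x = x]
  have p: "Ck_on 1 UNIV ?p" by (rule Ck_on_1_mult[OF f(1) R(1)])
  have pd: "partial_deriv i ?p = (\<lambda>y. partial_deriv i f y * \<rho> (x - y) - f y * partial_deriv i \<rho> (x - y))"
    using Ck_on_1D(1)[OF f(1)] Ck_on_1D(1)[OF R(1)]
    by (intro ext, subst partial_deriv_mult) (auto simp: R(2) algebra_simps)
  have c1: "continuous_on UNIV (\<lambda>y. partial_deriv i f y * \<rho> (x - y))"
    by (intro continuous_on_mult Ck_on_1D(2)[OF f(1)] Ck_on_1D(3)[OF R(1)])
  have c2: "continuous_on UNIV (\<lambda>y. f y * partial_deriv i \<rho> (x - y))"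
    using continuous_on_mult[OF Ck_on_1D(3)[OF f(1)] continuous_on_minus[OF Ck_on_1D(2)[OF R(1), of i]]]
    by (simp add: R(2)[abs_def])
  have "integral\<^sup>L lebesgue (partial_deriv i ?p) = 0"
    by (rule integral_partial_deriv_eq_0[OF p, of a b]) (simp add: f(2))
  then have "integral (cbox a b) (partial_deriv i ?p) = 0"
    using integral_cont_compact_support(2)[OF Ck_on_1D(2)[OF p, of i], of a b]
      partial_deriv_zero_outside[OF closed_cbox, of a b ?p] f(2) by simp
  then have "integral (cbox a b) (\<lambda>y. partial_deriv i f y * \<rho> (x - y) - f y * partial_deriv i \<rho> (x - y)) = 0"
    by (simp only: pd)
  moreover have "(\<lambda>y. partial_deriv i f y * \<rho> (x - y)) integrable_on cbox a b"
    "(\<lambda>y. f y * partial_deriv i \<rho> (x - y)) integrable_on cbox a b"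
    using c1 c2 by (auto intro!: integrable_continuous intro: continuous_on_subset)
  ultimately show ?thesis
    by (simp add: conv_def Henstock_Kurzweil_Integration.integral_diff)
qed

lemma exists_mollifier:
  assumes "\<delta> > 0"
  shows "\<exists>(\<rho> :: real^'m::finite \<Rightarrow> real) r s. \<rho> \<in> smooth_alg \<and> (\<forall>x. \<rho> x \<ge> 0) \<and>
    integral\<^sup>L lebesgue \<rho> = 1 \<and> (\<forall>x. x \<notin> cbox r s \<longrightarrow> \<rho> x = 0) \<and> (\<forall>x. \<rho> x \<noteq> 0 \<longrightarrow> norm x < \<delta>)"
proof -
  obtain r s :: "real^'m" where rs: "0 \<in> box r s" "box r s \<subseteq> ball 0 \<delta>"
    using rational_boxes[OF assms, of 0] by metis
  let ?\<eta> = "box_bump r s"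
  have c: "continuous_on UNIV ?\<eta>"
    using smooth_alg_Ck_on[OF box_bump_smooth, of 0] by simp
  have out: "?\<eta> x = 0" if "x \<notin> cbox r s" for x
    using that box_subset_cbox by (auto simp: box_bump_eq_0_iff)
  have int: "integrable lebesgue ?\<eta>"
    using integral_cont_compact_support(1)[OF c out] .
  have nonneg: "0 \<le> integral\<^sup>L lebesgue ?\<eta>"
    by (rule Bochner_Integration.integral_nonneg) (rule box_bump_nonneg)
  have "integral\<^sup>L lebesgue ?\<eta> \<noteq> 0"
  proof
    assume "integral\<^sup>L lebesgue ?\<eta> = 0"
    then have "AE x in lebesgue. ?\<eta> x = 0"
      by (subst (asm) integral_nonneg_eq_0_iff_AE[OF int]) (simp_all add: box_bump_nonneg)
    moreover have "closed (?\<eta> -` {0})"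
      using continuous_closed_vimage[of "{0}" ?\<eta>] c by (simp add: continuous_on_eq_continuous_at)
    ultimately have "0 \<in> ?\<eta> -` {0}"
      by (intro mem_closed_if_AE_lebesgue) auto
    then show False using rs by (simp add: box_bump_eq_0_iff)
  qed
  then have pos: "integral\<^sup>L lebesgue ?\<eta> > 0"
    using nonneg by (simp add: less_le)
  let ?\<rho> = "\<lambda>x. inverse (integral\<^sup>L lebesgue ?\<eta>) * ?\<eta> x"
  show ?thesis
  proof (rule exI[of _ ?\<rho>], rule exI[of _ r], rule exI[of _ s], intro conjI allI impI)
    show "?\<rho> \<in> smooth_alg" by (intro smooth_alg.intros box_bump_smooth)
    show "?\<rho> x \<ge> 0" for x using pos box_bump_nonneg[of r s x] by simp
    show "integral\<^sup>L lebesgue ?\<rho> = 1" using pos by simp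
    show "?\<rho> x = 0" if "x \<notin> cbox r s" for x using out[OF that] by simp
    show "norm x < \<delta>" if "?\<rho> x \<noteq> 0" for x
    proof -
      have "x \<in> box r s" using that box_bump_eq_0_iff[of r s x] by auto
      then show ?thesis using rs(2) by auto
    qed
  qed
qed

text \<open>Mollification at a scale below the distance from \<open>K\<close> to the complement of \<open>\<Omega>\<close> and below the scales of
  uniform continuity of \<open>\<phi>\<close> and of its gradient.\<close>

lemma test_function_approx:
  fixes \<phi> :: "real^'m::finite \<Rightarrow> real"
  assumes \<phi>: "Ck_on 1 UNIV \<phi>" and K: "compact K" "K \<subseteq> \<Omega>" "open \<Omega>"
    and supp: "\<And>x. x \<notin> K \<Longrightarrow> \<phi> x = 0" and "e > 0"
  obtains \<psi> where "test_function \<Omega> \<psi>" "\<And>x. \<bar>\<phi> x - \<psi> x\<bar> \<le> e"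
    "\<And>i x. \<bar>partial_deriv i \<phi> x - partial_deriv i \<psi> x\<bar> \<le> e"
proof -
  obtain a where a: "K \<subseteq> cbox (- a) a"
    using bounded_subset_cbox_symmetric[OF compact_imp_bounded[OF K(1)]] .
  have supp': "\<phi> x = 0" if "x \<notin> cbox (- a) a" for x using supp a that by blast
  have suppd: "partial_deriv i \<phi> x = 0" if "x \<notin> cbox (- a) a" for x i
    by (rule partial_deriv_zero_outside[OF closed_cbox supp' that])
  have suppg: "grad \<phi> x = 0" if "x \<notin> cbox (- a) a" for x
    using suppd[OF that] by (simp add: vec_eq_iff)
  obtain r where r: "r > 0" "(\<Union>x\<in>K. cball x r) \<subseteq> \<Omega>"
    using compact_subset_open_imp_cball_epsilon_subset[OF K(1) K(3) K(2)] .
  obtain d1 where d1: "d1 > 0" "\<forall>x y. norm (x - y) < d1 \<longrightarrow> norm (\<phi> x - \<phi> y) \<le> e"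
    using uniformly_continuous_compact_support[OF Ck_on_1D(3)[OF \<phi>] supp' \<open>e > 0\<close>] by blast
  obtain d2 where d2: "d2 > 0" "\<forall>x y. norm (x - y) < d2 \<longrightarrow> norm (grad \<phi> x - grad \<phi> y) \<le> e"
    using uniformly_continuous_compact_support[OF Ck_on_1_continuous_grad[OF \<phi>] suppg \<open>e > 0\<close>] by blast
  define \<delta> where "\<delta> = min r (min d1 d2)"
  have "\<delta> > 0" using r d1 d2 by (simp add: \<delta>_def)
  obtain \<rho> :: "real^'m \<Rightarrow> real" and l s where "\<rho> \<in> smooth_alg \<and> (\<forall>x. \<rho> x \<ge> 0) \<and>
    integral\<^sup>L lebesgue \<rho> = 1 \<and> (\<forall>x. x \<notin> cbox l s \<longrightarrow> \<rho> x = 0) \<and> (\<forall>x. \<rho> x \<noteq> 0 \<longrightarrow> norm x < \<delta>)"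
    using exists_mollifier[OF \<open>\<delta> > 0\<close>, where 'm = 'm] by blast
  then have \<rho>: "\<rho> \<in> smooth_alg" "\<And>x. \<rho> x \<ge> 0" "integral\<^sup>L lebesgue \<rho> = 1"
    "\<And>x. x \<notin> cbox l s \<Longrightarrow> \<rho> x = 0" "\<And>x. \<rho> x \<noteq> 0 \<Longrightarrow> norm x < \<delta>"
    by blast+
  have \<rho>1: "Ck_on 1 UNIV \<rho>" "continuous_on UNIV \<rho>"
    using smooth_alg_Ck_on[OF \<rho>(1), of 1] smooth_alg_Ck_on[OF \<rho>(1), of 0] by simp_all
  let ?\<psi> = "conv (- a) a \<phi> \<rho>"
  have c\<phi>: "continuous_on (cbox (- a) a) \<phi>"
    using Ck_on_1D(3)[OF \<phi>] continuous_on_subset by blast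
  show thesis
  proof (rule that)
    let ?S = "{x + y |x y. x \<in> K \<and> y \<in> cball 0 r}"
    have comp: "compact ?S"
      by (rule compact_sums[OF K(1) compact_cball])
    have S: "?S \<subseteq> \<Omega>"
    proof safe
      fix x y :: "real^'m" assume "x \<in> K" "y \<in> cball 0 r"
      then have "x + y \<in> cball x r" by (simp add: dist_norm)
      with \<open>x \<in> K\<close> r(2) show "x + y \<in> \<Omega>" by blast
    qed
    have "{x. ?\<psi> x \<noteq> 0} \<subseteq> ?S"
    proof safe
      fix x assume "?\<psi> x \<noteq> 0"
      have "\<exists>y. \<phi> y * \<rho> (x - y) \<noteq> 0"
      proof (rule ccontr)
        assume "\<nexists>y. \<phi> y * \<rho> (x - y) \<noteq> 0"
        then have "(\<lambda>y. \<phi> y * \<rho> (x - y)) = (\<lambda>y. 0)" by blast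
        with \<open>?\<psi> x \<noteq> 0\<close> show False unfolding conv_def by simp
      qed
      then obtain y where y: "\<phi> y * \<rho> (x - y) \<noteq> 0" by blast
      then have "y \<in> K" "norm (x - y) < \<delta>" using supp \<rho>(5) by auto
      then show "\<exists>x' y. x = x' + y \<and> x' \<in> K \<and> y \<in> cball 0 r"
        by (intro exI[of _ y] exI[of _ "x - y"]) (simp add: \<delta>_def)
    qed
    then have cl: "closure {x. ?\<psi> x \<noteq> 0} \<subseteq> ?S"
      by (intro closure_minimal compact_imp_closed[OF comp])
    have "compact (closure {x. ?\<psi> x \<noteq> 0})"
      using compact_Int_closed[OF comp closed_closure[of "{x. ?\<psi> x \<noteq> 0}"]] cl
      by (simp add: Int_absorb1)
    then show "test_function \<Omega> ?\<psi>"
      unfolding test_function_def using conv_Ck_on[OF c\<phi> \<rho>(1)] cl S by blast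
    show "\<bar>\<phi> x - ?\<psi> x\<bar> \<le> e" for x
    proof -
      have "\<bar>?\<psi> x - \<phi> x\<bar> \<le> e"
      proof (rule conv_close[OF Ck_on_1D(3)[OF \<phi>] supp' \<rho>1(2) \<rho>(4) \<rho>(2,3)])
        fix x y assume "\<rho> (x - y) \<noteq> 0"
        then have "norm (y - x) < d1"
          using \<rho>(5)[of "x - y"] by (simp add: \<delta>_def norm_minus_commute)
        then show "\<bar>\<phi> y - \<phi> x\<bar> \<le> e"
          using d1(2) by simp
      qed
      then show ?thesis by (simp add: abs_minus_commute)
    qed
    show "\<bar>partial_deriv i \<phi> x - partial_deriv i ?\<psi> x\<bar> \<le> e" for i x
    proof -
      have "partial_deriv i ?\<psi> x = conv (- a) a (partial_deriv i \<phi>) \<rho> x"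
        using conv_derivative(2)[OF c\<phi> \<rho>1(1)] conv_partial_swap[OF \<phi> supp' \<rho>1(1)] by simp
      moreover have "\<bar>conv (- a) a (partial_deriv i \<phi>) \<rho> x - partial_deriv i \<phi> x\<bar> \<le> e"
      proof (rule conv_close[OF Ck_on_1D(2)[OF \<phi>] suppd \<rho>1(2) \<rho>(4) \<rho>(2,3)])
        fix x y assume "\<rho> (x - y) \<noteq> 0"
        then have "norm (y - x) < d2"
          using \<rho>(5)[of "x - y"] by (simp add: \<delta>_def norm_minus_commute)
        then have "norm (grad \<phi> y - grad \<phi> x) \<le> e"
          using d2(2) by simp
        then show "\<bar>partial_deriv i \<phi> y - partial_deriv i \<phi> x\<bar> \<le> e"
          using component_le_norm_cart[of "grad \<phi> y - grad \<phi> x" i] by simp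
      qed
      ultimately show ?thesis by (simp add: abs_minus_commute)
    qed
  qed
qed

lemma Ck_on_1_zero_extension:
  fixes g :: "real^'m::finite \<Rightarrow> real"
  assumes "open \<Omega>" "closed K" "K \<subseteq> \<Omega>" "Ck_on 1 \<Omega> g" and supp: "\<And>x. x \<in> \<Omega> \<Longrightarrow> x \<notin> K \<Longrightarrow> g x = 0"
  shows "Ck_on 1 UNIV (\<lambda>x. if x \<in> \<Omega> then g x else 0)"
    and "partial_deriv i (\<lambda>x. if x \<in> \<Omega> then g x else 0) x = (if x \<in> \<Omega> then partial_deriv i g x else 0)"
proof -
  let ?E = "\<lambda>x. if x \<in> \<Omega> then g x else 0"
  have in\<Omega>: "?E differentiable (at x)" "partial_deriv i ?E x = partial_deriv i g x" if "x \<in> \<Omega>" for x i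
    using partial_deriv_cong_open[OF assms(1) that, of ?E g] Ck_on_1D(1)[OF assms(4) that] by simp_all
  have out: "?E differentiable (at x)" "partial_deriv i ?E x = 0" if "x \<notin> K" for x i
  proof -
    have "?E differentiable (at x)" "partial_deriv i ?E x = partial_deriv i (\<lambda>_. 0) x"
      using partial_deriv_cong_open[of "- K" x ?E "\<lambda>_. 0"] assms(2) that supp by (simp_all add: open_Compl)
    then show "?E differentiable (at x)" "partial_deriv i ?E x = 0" by simp_all
  qed
  show "partial_deriv i ?E x = (if x \<in> \<Omega> then partial_deriv i g x else 0)"
  proof (cases "x \<in> \<Omega>")
    case True
    then show ?thesis using in\<Omega>(2)[OF True] by simp
  next
    case False
    then have "x \<notin> K" using assms(3) by blast
    then show ?thesis using False out(2) by simp
  qed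
  have "continuous_on \<Omega> (partial_deriv i ?E)" for i
    using Ck_on_1D(2)[OF assms(4), of i] by (subst continuous_on_cong[OF refl in\<Omega>(2)])
  moreover have "continuous_on (- K) (partial_deriv i ?E)" for i
    by (subst continuous_on_cong[OF refl out(2)]) simp_all
  ultimately have "continuous_on (\<Omega> \<union> - K) (partial_deriv i ?E)" for i
    using assms(1,2) continuous_on_open_Un open_Compl by blast
  moreover have "\<Omega> \<union> - K = UNIV" using assms(3) by blast
  moreover have "?E differentiable (at x)" for x
    using in\<Omega>(1) out(1) assms(3) by blast
  ultimately show "Ck_on 1 UNIV ?E" unfolding Ck_on_1_iff by metis
qed

section \<open>Integration by parts and the fundamental lemma\<close>

lemma integrable_restrict_compact_support:
  fixes h k :: "real^'m::finite \<Rightarrow> real"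
  assumes h: "continuous_on \<Omega> h" and k: "continuous_on \<Omega> k"
    and K: "compact K" "K \<subseteq> \<Omega>" "\<And>x. x \<notin> K \<Longrightarrow> k x = 0"
  shows "set_integrable lebesgue \<Omega> (\<lambda>x. h x * k x)"
proof -
  have "continuous_on K (\<lambda>x. h x * k x)"
    using continuous_on_mult[OF h k] K(2) continuous_on_subset by blast
  then have "integrable lborel (\<lambda>x. indicator K x *\<^sub>R (h x * k x))"
    by (rule borel_integrable_compact[OF K(1)])
  then have "integrable lebesgue (\<lambda>x. indicator K x *\<^sub>R (h x * k x))"
    by (subst integrable_completion) simp_all
  moreover have "(\<lambda>x. indicator K x *\<^sub>R (h x * k x)) = (\<lambda>x. indicator \<Omega> x *\<^sub>R (h x * k x))"
    using K(2,3) by (fastforce simp: indicator_def)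
  ultimately show ?thesis unfolding set_integrable_def by simp
qed

lemma test_functionD:
  assumes "test_function \<Omega> \<psi>"
  shows "Ck_on 1 UNIV \<psi>" "compact (closure {x. \<psi> x \<noteq> 0})" "closure {x. \<psi> x \<noteq> 0} \<subseteq> \<Omega>"
    "x \<notin> closure {x. \<psi> x \<noteq> 0} \<Longrightarrow> \<psi> x = 0"
  using assms closure_subset[of "{x. \<psi> x \<noteq> 0}"] unfolding test_function_def by blast+

lemma integration_by_parts_test_function:
  fixes f :: "real^'m::finite \<Rightarrow> real"
  assumes "open \<Omega>" and f: "Ck_on 1 \<Omega> f" and \<psi>: "test_function \<Omega> \<psi>"
  shows "set_integrable lebesgue \<Omega> (\<lambda>x. f x * partial_deriv i \<psi> x)"
    and "set_integrable lebesgue \<Omega> (\<lambda>x. partial_deriv i f x * \<psi> x)"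
    and "(LINT x:\<Omega>|lebesgue. f x * partial_deriv i \<psi> x) = - (LINT x:\<Omega>|lebesgue. partial_deriv i f x * \<psi> x)"
proof -
  define K where "K = closure {x. \<psi> x \<noteq> 0}"
  note \<psi>' = test_functionD[OF \<psi>, folded K_def]
  have \<psi>\<Omega>: "Ck_on 1 \<Omega> \<psi>" using Ck_on_1_mono[OF \<psi>'(1)] by simp
  have "closed K" by (rule compact_imp_closed[OF \<psi>'(2)])
  then have pd0: "partial_deriv i \<psi> x = 0" if "x \<notin> K" for x
    using partial_deriv_zero_outside[of K \<psi>] \<psi>'(4) that by metis
  show i1: "set_integrable lebesgue \<Omega> (\<lambda>x. f x * partial_deriv i \<psi> x)"
    by (rule integrable_restrict_compact_support[OF Ck_on_1D(3)[OF f] Ck_on_1D(2)[OF \<psi>\<Omega>] \<psi>'(2,3) pd0])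
  show i2: "set_integrable lebesgue \<Omega> (\<lambda>x. partial_deriv i f x * \<psi> x)"
    by (rule integrable_restrict_compact_support[OF Ck_on_1D(2)[OF f] Ck_on_1D(3)[OF \<psi>\<Omega>] \<psi>'(2,3) \<psi>'(4)])
  let ?p = "\<lambda>x. if x \<in> \<Omega> then f x * \<psi> x else 0"
  have f\<psi>: "Ck_on 1 \<Omega> (\<lambda>x. f x * \<psi> x)" by (rule Ck_on_1_mult[OF f \<psi>\<Omega>])
  have f\<psi>0: "f x * \<psi> x = 0" if "x \<in> \<Omega>" "x \<notin> K" for x using \<psi>'(4)[OF that(2)] by simp
  note ext = Ck_on_1_zero_extension[OF assms(1) compact_imp_closed[OF \<psi>'(2)] \<psi>'(3) f\<psi> f\<psi>0]
  obtain a where a: "K \<subseteq> cbox (- a) a"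
    using bounded_subset_cbox_symmetric[OF compact_imp_bounded[OF \<psi>'(2)]] .
  have "integral\<^sup>L lebesgue (partial_deriv i ?p) = 0"
  proof (rule integral_partial_deriv_eq_0[OF ext(1), of "- a" a])
    show "?p x = 0" if "x \<notin> cbox (- a) a" for x
    proof -
      have "x \<notin> K" using that a by blast
      then show ?thesis using f\<psi>0[of x] by simp
    qed
  qed
  moreover have "partial_deriv i ?p = (\<lambda>x. indicator \<Omega> x *\<^sub>R (f x * partial_deriv i \<psi> x + partial_deriv i f x * \<psi> x))"
    using Ck_on_1D(1)[OF f] Ck_on_1D(1)[OF \<psi>\<Omega>] by (intro HOL.ext) (simp add: ext(2) partial_deriv_mult)
  ultimately have "(LINT x:\<Omega>|lebesgue. f x * partial_deriv i \<psi> x + partial_deriv i f x * \<psi> x) = 0"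
    unfolding set_lebesgue_integral_def by metis
  then show "(LINT x:\<Omega>|lebesgue. f x * partial_deriv i \<psi> x) = - (LINT x:\<Omega>|lebesgue. partial_deriv i f x * \<psi> x)"
    using set_integral_add(2)[OF i1 i2] by simp
qed

text \<open>Boxes form an intersection-stable generator of the Borel sets, and the sets over which \<open>f\<close> integrates
  to zero are closed under complements and disjoint unions.\<close>

lemma AE_zero_of_box_integrals_zero:
  fixes f :: "real^'m::finite \<Rightarrow> real"
  assumes f: "integrable lebesgue f" and box0: "\<And>a b. (LINT x:box a b|lebesgue. f x) = 0"
  shows "AE x in lebesgue. f x = 0"
proof (rule density_unique_real[OF f integrable_zero])
  have setint: "set_integrable lebesgue A f" if "A \<in> sets lebesgue" for A
    using integrable_mult_indicator[OF that f] by (simp add: set_integrable_def)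
  let ?A = "\<lambda>n::nat. box (\<chi> i. - real n) (\<chi> i. real n) :: (real^'m) set"
  have UN: "(\<Union>n. ?A n) = UNIV"
  proof -
    have "\<exists>n. x \<in> ?A n" for x
    proof -
      obtain n where "norm x < real n" using reals_Archimedean2 by blast
      then have "\<bar>x $ i\<bar> < real n" for i
        using component_le_norm_cart[of x i] by linarith
      then have "x \<in> ?A n" by (simp add: mem_box_cart abs_less_iff minus_less_iff)
      then show ?thesis by blast
    qed
    then show ?thesis by blast
  qed
  have "(\<lambda>n. LINT x:?A n|lebesgue. f x) \<longlonglongrightarrow> (LINT x:(\<Union>n. ?A n)|lebesgue. f x)"
  proof (rule set_integral_cont_up)
    show "incseq ?A"
    proof (rule incseq_SucI, rule subsetI)
      fix n x assume x: "x \<in> ?A n"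
      have "- real (Suc n) < x $ i \<and> x $ i < real (Suc n)" for i
      proof -
        have "- real n < x $ i \<and> x $ i < real n" using x by (simp add: mem_box_cart)
        then show ?thesis by simp
      qed
      then show "x \<in> ?A (Suc n)" by (simp only: mem_box_cart vec_lambda_beta) blast
    qed
    show "set_integrable lebesgue (\<Union>n. ?A n) f"
      unfolding UN by (rule setint) simp
  qed simp
  then have UNIV0: "(LINT x:UNIV|lebesgue. f x) = 0"
    unfolding UN box0 by (simp add: LIMSEQ_const_iff)
  have borel: "A \<in> sets borel \<and> (LINT x:A|lebesgue. f x) = 0"
    if "A \<in> sigma_sets UNIV (range (\<lambda>(a, b). box a b :: (real^'m) set))" for A
  proof -
    have "Int_stable (range (\<lambda>(a, b). box a b :: (real^'m) set))"
      by (auto simp: Int_stable_def box_Int_box)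
    moreover have "range (\<lambda>(a, b). box a b :: (real^'m) set) \<subseteq> Pow UNIV" by simp
    ultimately show ?thesis using that
    proof (induction rule: sigma_sets_induct_disjoint)
      case (basic A)
      then show ?case using box0 by auto
    next
      case empty
      then show ?case by (simp add: set_lebesgue_integral_def)
    next
      case (compl A)
      have "(LINT x:A \<union> (UNIV - A)|lebesgue. f x) = (LINT x:A|lebesgue. f x) + (LINT x:UNIV - A|lebesgue. f x)"
        by (rule set_integral_Un) (use compl in \<open>auto intro!: setint\<close>)
      then show ?case using compl UNIV0 by auto
    next
      case (union A)
      have "(LINT x:(\<Union>i. A i)|lebesgue. f x) = (\<Sum>i. (LINT x:(A i)|lebesgue. f x))"
      proof (rule lebesgue_integral_countable_add)
        show "set_integrable lebesgue (\<Union>i. A i) f"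
          using union by (intro setint) auto
      qed (use union in \<open>auto simp: disjoint_family_on_def\<close>)
      then show ?case using union by auto
    qed
  qed
  fix A :: "(real^'m) set" assume A: "A \<in> sets lebesgue"
  then obtain S N N' where SN: "A = S \<union> N" "N \<subseteq> N'" "N' \<in> null_sets lborel" "S \<in> sets lborel"
    by (rule sets_completionE)
  have N': "N' \<in> null_sets lebesgue" using SN(3) by (simp add: null_sets_completionI)
  have "(LINT x:A|lebesgue. f x) = (LINT x:S|lebesgue. f x)"
  proof (rule set_integral_null_delta[OF f A])
    show S: "S \<in> sets lebesgue" using SN(4) by auto
    show "A - S \<union> (S - A) \<in> null_sets lebesgue"
    proof (rule null_sets_subset[OF N'])
      show "A - S \<union> (S - A) \<in> sets lebesgue"
        by (rule sets.Un[OF sets.Diff[OF A S] sets.Diff[OF S A]])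
    qed (use SN in auto)
  qed
  also have "\<dots> = 0"
    using borel[of S] SN(4) by (simp add: borel_eq_box)
  finally show "(LINT x:A|lebesgue. f x) = (LINT x:A|lebesgue. 0)"
    by (simp add: set_lebesgue_integral_def)
qed

text \<open>The functions \<open>1 - exp (- n \<eta>)\<close> with \<open>\<eta>\<close> the smooth bump of the box, increase with
  \<open>n\<close> to the indicator of the set where \<open>\<eta>\<close> is positive, which is the open box.\<close>

lemma exists_test_functions_to_box:
  fixes a b :: "real^'m::finite"
  assumes "cbox a b \<subseteq> \<Omega>"
  shows "\<exists>\<psi>. (\<forall>n::nat. test_function \<Omega> (\<psi> n)) \<and> (\<forall>n x. \<bar>\<psi> n x\<bar> \<le> 1) \<and>
     (\<forall>n x. x \<notin> cbox a b \<longrightarrow> \<psi> n x = 0) \<and> (\<forall>x. (\<lambda>n. \<psi> n x) \<longlonglongrightarrow> indicator (box a b) x)"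
proof -
  define \<psi> where "\<psi> n x = 1 + (- 1) * exp ((- real n) * box_bump a b x)" for n x
  have alg: "\<psi> n \<in> smooth_alg" for n
    unfolding \<psi>_def[abs_def] by (intro smooth_alg.intros box_bump_smooth)
  have zero: "\<psi> n x = 0" if "x \<notin> box a b" for n x
    using that box_bump_eq_0_iff[of a b x] by (simp add: \<psi>_def)
  have cl: "closure {x. \<psi> n x \<noteq> 0} \<subseteq> cbox a b" for n
    by (rule closure_minimal) (use zero box_subset_cbox in blast)+
  have "test_function \<Omega> (\<psi> n)" for n
    unfolding test_function_def
  proof (intro conjI allI)
    show "compact (closure {x. \<psi> n x \<noteq> 0})"
      using compact_Int_closed[OF compact_cbox closed_closure, of a b "{x. \<psi> n x \<noteq> 0}"] cl[of n]
      by (simp add: Int_absorb1)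
  qed (use cl assms smooth_alg_Ck_on[OF alg] in blast)+
  moreover have "\<bar>\<psi> n x\<bar> \<le> 1" for n x
    using box_bump_nonneg[of a b x] by (simp add: \<psi>_def)
  moreover have "\<psi> n x = 0" if "x \<notin> cbox a b" for n x
    using zero that box_subset_cbox by blast
  moreover have "(\<lambda>n. \<psi> n x) \<longlonglongrightarrow> indicator (box a b) x" for x
  proof (cases "x \<in> box a b")
    case True
    then have q: "norm (exp (- box_bump a b x)) < 1"
      using box_bump_nonneg[of a b x] box_bump_eq_0_iff[of a b x] by (simp add: less_le)
    have "\<psi> n x = 1 - exp (- box_bump a b x) ^ n" for n
      by (simp add: \<psi>_def exp_of_nat_mult[symmetric])
    then show ?thesis
      using tendsto_diff[OF tendsto_const LIMSEQ_power_zero[OF q], of 1] True by simp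
  next
    case False
    then show ?thesis by (simp add: zero)
  qed
  ultimately show ?thesis by blast
qed

text \<open>Integrability is required only on compact boxes: the lemma is applied to the difference of a weak
  gradient and a classical gradient, and the latter is not known in advance to be integrable on \<open>\<Omega>\<close>.\<close>

lemma fundamental_lemma_calculus_of_variations:
  fixes f :: "real^'m::finite \<Rightarrow> real"
  assumes "open \<Omega>"
    and int: "\<And>a b. cbox a b \<subseteq> \<Omega> \<Longrightarrow> set_integrable lebesgue (cbox a b) f"
    and test: "\<And>\<psi>. test_function \<Omega> \<psi> \<Longrightarrow> (LINT x:\<Omega>|lebesgue. f x * \<psi> x) = 0"
  shows "AE x in lebesgue. x \<in> \<Omega> \<longrightarrow> f x = 0"
proof -
  have box0: "(LINT x:box a b|lebesgue. f x) = 0" if ab: "cbox a b \<subseteq> \<Omega>" for a b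
  proof -
    obtain \<psi> where \<psi>: "\<forall>n::nat. test_function \<Omega> (\<psi> n)" "\<forall>n x. \<bar>\<psi> n x\<bar> \<le> 1"
      "\<forall>n x. x \<notin> cbox a b \<longrightarrow> \<psi> n x = 0" "\<forall>x. (\<lambda>n. \<psi> n x) \<longlonglongrightarrow> indicator (box a b) x"
      using exists_test_functions_to_box[OF ab] by blast
    define g where "g x = indicator (cbox a b) x *\<^sub>R f x" for x
    have g: "integrable lebesgue g" using int[OF ab] by (simp add: set_integrable_def g_def[abs_def])
    have \<psi>m [measurable]: "\<psi> n \<in> borel_measurable lebesgue" for n
    proof -
      have "\<psi> n \<in> borel_measurable borel"
        by (rule borel_measurable_continuous_onI[OF Ck_on_1D(3)[OF test_functionD(1)[OF spec[OF \<psi>(1)]]]])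
      then show ?thesis by (simp add: measurable_completion)
    qed
    have [measurable]: "(indicator (box a b) :: _ \<Rightarrow> real) \<in> borel_measurable lebesgue"
      by (rule borel_measurable_indicator) simp
    have [measurable]: "g \<in> borel_measurable lebesgue" using g by (rule borel_measurable_integrable)
    have "(\<lambda>n. LINT x|lebesgue. g x * \<psi> n x) \<longlonglongrightarrow> (LINT x|lebesgue. g x * indicator (box a b) x)"
    proof (rule integral_dominated_convergence[where w = "\<lambda>x. norm (g x)"])
      show "integrable lebesgue (\<lambda>x. norm (g x))" by (rule integrable_norm[OF g])
      show "AE x in lebesgue. (\<lambda>n. g x * \<psi> n x) \<longlonglongrightarrow> g x * indicator (box a b) x"
        using \<psi>(4) by (intro AE_I2 tendsto_mult tendsto_const) blast
      show "AE x in lebesgue. norm (g x * \<psi> n x) \<le> norm (g x)" for n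
        using \<psi>(2) by (intro AE_I2) (simp add: abs_mult mult_left_le)
    qed measurable
    moreover have "(LINT x|lebesgue. g x * \<psi> n x) = 0" for n
    proof -
      have "(\<lambda>x. g x * \<psi> n x) = (\<lambda>x. indicator \<Omega> x *\<^sub>R (f x * \<psi> n x))"
      proof
        fix x show "g x * \<psi> n x = indicator \<Omega> x *\<^sub>R (f x * \<psi> n x)"
          using \<psi>(3)[rule_format, of x n] ab by (cases "x \<in> cbox a b") (auto simp: subset_iff g_def)
      qed
      then show ?thesis using test[of "\<psi> n"] \<psi>(1) by (simp add: set_lebesgue_integral_def)
    qed
    ultimately have "(LINT x|lebesgue. g x * indicator (box a b) x) = 0"
      by (simp add: LIMSEQ_const_iff)
    moreover have "(\<lambda>x. g x * indicator (box a b) x) = (\<lambda>x. indicator (box a b) x *\<^sub>R f x)"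
    proof
      fix x show "g x * indicator (box a b) x = indicator (box a b) x *\<^sub>R f x"
        using box_subset_cbox[of a b] by (cases "x \<in> box a b") (auto simp: g_def subset_iff)
    qed
    ultimately show ?thesis by (simp add: set_lebesgue_integral_def)
  qed
  have AEbox: "AE x in lebesgue. x \<in> cbox a b \<longrightarrow> f x = 0" if ab: "cbox a b \<subseteq> \<Omega>" for a b
  proof -
    let ?g = "\<lambda>x. indicator (box a b) x *\<^sub>R f x"
    have "set_integrable lebesgue (box a b) f"
      by (rule set_integrable_subset[OF int[OF ab]]) (auto simp: box_subset_cbox)
    then have g: "integrable lebesgue ?g" by (simp add: set_integrable_def)
    have "(LINT x:box c d|lebesgue. ?g x) = 0" for c d
    proof -
      obtain p q where pq: "box c d \<inter> box a b = box p q"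
        using box_Int_box[of c d a b] by blast
      have "(LINT x:box c d|lebesgue. ?g x) = (LINT x:box p q|lebesgue. f x)"
        unfolding set_lebesgue_integral_def pq[symmetric]
        by (intro Bochner_Integration.integral_cong) (auto simp: indicator_def)
      also have "\<dots> = 0"
      proof (cases "box p q = {}")
        case False
        then have "cbox p q \<subseteq> closure (box a b)"
          using pq closure_mono[of "box p q" "box a b"] closure_box[OF False] by blast
        also have "\<dots> \<subseteq> cbox a b" by (rule closure_minimal[OF box_subset_cbox closed_cbox])
        finally show ?thesis using box0 ab by blast
      qed (simp add: set_lebesgue_integral_def)
      finally show ?thesis .
    qed
    then have "AE x in lebesgue. ?g x = 0"
      by (rule AE_zero_of_box_integrals_zero[OF g])
    moreover have "AE x in lebesgue. x \<notin> cbox a b - box a b"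
      using negligible_frontier_interval[of a b]
      by (intro AE_not_in) (simp add: negligible_iff_null_sets)
    ultimately show ?thesis by eventually_elim (auto simp: indicator_def)
  qed
  obtain \<D> where \<D>: "countable \<D>" "\<D> \<subseteq> Pow \<Omega>" "\<forall>X\<in>\<D>. \<exists>a b. X = cbox a b" "\<Union>\<D> = \<Omega>"
    using open_countable_Union_open_cbox[OF assms(1)] by metis
  have "AE x in lebesgue. \<forall>X\<in>\<D>. x \<in> X \<longrightarrow> f x = 0"
    unfolding AE_ball_countable[OF \<D>(1)]
  proof
    fix X assume X: "X \<in> \<D>"
    then obtain a b where "X = cbox a b" using \<D>(3) by blast
    with X \<D>(2) AEbox[of a b] show "AE x in lebesgue. x \<in> X \<longrightarrow> f x = 0" by blast
  qed
  then show ?thesis by eventually_elim (use \<D>(4) in blast)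
qed

section \<open>Weak gradients of continuously differentiable functions\<close>

lemma set_integrable_component:
  assumes "set_integrable M A (g :: 'a \<Rightarrow> real^'m::finite)"
  shows "set_integrable M A (\<lambda>x. g x $ i)"
  using integrable_bounded_linear[OF bounded_linear_vec_nth assms[unfolded set_integrable_def], of i]
  by (simp add: set_integrable_def)

lemma bounded_compact_support:
  fixes k :: "real^'m::finite \<Rightarrow> real"
  assumes "continuous_on UNIV k" "compact K" "\<And>x. x \<notin> K \<Longrightarrow> k x = 0"
  obtains C where "\<forall>x. \<bar>k x\<bar> \<le> C"
proof -
  have "bounded (k ` K)"
    by (rule compact_imp_bounded[OF compact_continuous_image[OF continuous_on_subset[OF assms(1) subset_UNIV] assms(2)]])
  then obtain C where C: "\<forall>y\<in>k ` K. norm y \<le> C" unfolding bounded_iff by blast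
  have "\<bar>k x\<bar> \<le> max C 0" for x
  proof (cases "x \<in> K")
    case True
    then have "norm (k x) \<le> C" using C by blast
    then show ?thesis by simp
  next
    case False
    then show ?thesis using assms(3) by simp
  qed
  then show thesis using that by blast
qed

lemma set_integrable_mult_bounded:
  fixes h k :: "real^'m::finite \<Rightarrow> real"
  assumes h: "set_integrable lebesgue \<Omega> h" and k: "k \<in> borel_measurable lebesgue" "\<forall>x. \<bar>k x\<bar> \<le> C"
  shows "set_integrable lebesgue \<Omega> (\<lambda>x. h x * k x)"
proof -
  let ?g = "\<lambda>x. indicator \<Omega> x *\<^sub>R h x"
  have g: "integrable lebesgue ?g" using h by (simp add: set_integrable_def)
  have "integrable lebesgue (\<lambda>x. ?g x * k x)"
  proof (rule Bochner_Integration.integrable_bound)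
    show "integrable lebesgue (\<lambda>x. C * norm (?g x))" using integrable_norm[OF g] by (rule integrable_mult_right)
    show "(\<lambda>x. ?g x * k x) \<in> borel_measurable lebesgue"
      by (rule borel_measurable_times[OF borel_measurable_integrable[OF g] k(1)])
    show "AE x in lebesgue. norm (?g x * k x) \<le> norm (C * norm (?g x))"
    proof (rule AE_I2)
      fix x
      have "\<bar>k x\<bar> \<le> \<bar>C\<bar>" using k(2)[rule_format, of x] by linarith
      then show "norm (?g x * k x) \<le> norm (C * norm (?g x))"
        using mult_left_mono[of "\<bar>k x\<bar>" "\<bar>C\<bar>" "\<bar>?g x\<bar>"] by (simp only: abs_mult real_norm_def abs_abs abs_ge_zero mult.commute)
    qed
  qed
  then show ?thesis by (simp add: set_integrable_def mult.assoc)
qed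

lemma test_function_measurable_bounded:
  assumes "test_function \<Omega> (\<psi> :: real^'m::finite \<Rightarrow> real)"
  shows "\<psi> \<in> borel_measurable lebesgue" "\<exists>C. \<forall>x. \<bar>\<psi> x\<bar> \<le> C"
proof -
  have c: "continuous_on UNIV \<psi>" by (rule Ck_on_1D(3)[OF test_functionD(1)[OF assms]])
  then have "\<psi> \<in> borel_measurable borel" by (rule borel_measurable_continuous_onI)
  then show "\<psi> \<in> borel_measurable lebesgue" by (simp add: measurable_completion)
  show "\<exists>C. \<forall>x. \<bar>\<psi> x\<bar> \<le> C"
    using bounded_compact_support[OF c test_functionD(2,4)[OF assms]] by metis
qed

text \<open>Both gradients satisfy the same integration by parts formula against test functions, so their
  difference is annihilated by all of them.\<close>

lemma weak_gradient_unique: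
  fixes f :: "real^'m::finite \<Rightarrow> real"
  assumes "open \<Omega>" and f: "Ck_on 1 \<Omega> f" and g: "has_L1_weak_gradient \<Omega> f g"
  shows "AE x in lebesgue. x \<in> \<Omega> \<longrightarrow> g x = grad f x"
proof -
  have gi: "set_integrable lebesgue \<Omega> (\<lambda>x. g x $ i)" for i
    using g set_integrable_component unfolding has_L1_weak_gradient_def by blast
  have "AE x in lebesgue. x \<in> \<Omega> \<longrightarrow> g x $ i - partial_deriv i f x = 0" for i
  proof (rule fundamental_lemma_calculus_of_variations[OF assms(1)])
    fix a b assume ab: "cbox a b \<subseteq> \<Omega>"
    have "set_integrable lebesgue (cbox a b) (partial_deriv i f)"
      by (rule absolutely_integrable_continuous[OF continuous_on_subset[OF Ck_on_1D(2)[OF f] ab]])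
    moreover have "set_integrable lebesgue (cbox a b) (\<lambda>x. g x $ i)"
      by (rule set_integrable_subset[OF gi _ ab]) simp
    ultimately show "set_integrable lebesgue (cbox a b) (\<lambda>x. g x $ i - partial_deriv i f x)"
      by (intro set_integral_diff(1))
  next
    fix \<psi> assume \<psi>: "test_function \<Omega> \<psi>"
    note ibp = integration_by_parts_test_function[OF assms(1) f \<psi>, of i]
    obtain C where C: "\<forall>x. \<bar>\<psi> x\<bar> \<le> C" using test_function_measurable_bounded(2)[OF \<psi>] by blast
    have g\<psi>: "set_integrable lebesgue \<Omega> (\<lambda>x. g x $ i * \<psi> x)"
      by (rule set_integrable_mult_bounded[OF gi test_function_measurable_bounded(1)[OF \<psi>] C])
    have "(LINT x:\<Omega>|lebesgue. (g x $ i - partial_deriv i f x) * \<psi> x) =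
      (LINT x:\<Omega>|lebesgue. g x $ i * \<psi> x) - (LINT x:\<Omega>|lebesgue. partial_deriv i f x * \<psi> x)"
      unfolding left_diff_distrib by (rule set_integral_diff(2)[OF g\<psi> ibp(2)])
    moreover have "(LINT x:\<Omega>|lebesgue. f x * partial_deriv i \<psi> x) = - (LINT x:\<Omega>|lebesgue. g x $ i * \<psi> x)"
      using g \<psi> unfolding has_L1_weak_gradient_def by blast
    ultimately show "(LINT x:\<Omega>|lebesgue. (g x $ i - partial_deriv i f x) * \<psi> x) = 0"
      using ibp(3) by linarith
  qed
  then have "AE x in lebesgue. \<forall>i. x \<in> \<Omega> \<longrightarrow> g x $ i - partial_deriv i f x = 0"
    by (subst AE_all_countable) blast
  then show ?thesis by eventually_elim (simp add: vec_eq_iff)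
qed

lemma indicator_continuous_measurable:
  fixes f :: "real^'m::finite \<Rightarrow> 'b::real_normed_vector"
  assumes "open \<Omega>" "continuous_on \<Omega> f"
  shows "(\<lambda>x. indicator \<Omega> x *\<^sub>R f x) \<in> borel_measurable lebesgue"
proof -
  have "(\<lambda>x. indicator \<Omega> x *\<^sub>R f x) \<in> borel_measurable borel"
    using borel_measurable_continuous_on_indicator[of \<Omega> f] assms by simp
  then show ?thesis by (simp add: measurable_completion)
qed

lemma W11_C1:
  fixes f :: "real^'m::finite \<Rightarrow> real"
  assumes "open \<Omega>" and f: "Ck_on 1 \<Omega> f" and "f \<in> W11 \<Omega>"
  shows "AE x in lebesgue. x \<in> \<Omega> \<longrightarrow> weak_gradient \<Omega> f x = grad f x"
    and "set_integrable lebesgue \<Omega> (grad f)" and "set_integrable lebesgue \<Omega> f"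
    and "set_integrable lebesgue \<Omega> (weak_gradient \<Omega> f)"
proof -
  show "set_integrable lebesgue \<Omega> f" using assms(3) by (simp add: W11_def)
  have ex: "\<exists>g. has_L1_weak_gradient \<Omega> f g" using assms(3) by (simp add: W11_def)
  have wg: "has_L1_weak_gradient \<Omega> f (weak_gradient \<Omega> f)"
    unfolding weak_gradient_def by (rule someI_ex[OF ex])
  then show 1: "AE x in lebesgue. x \<in> \<Omega> \<longrightarrow> weak_gradient \<Omega> f x = grad f x"
    by (rule weak_gradient_unique[OF assms(1,2)])
  show wi: "set_integrable lebesgue \<Omega> (weak_gradient \<Omega> f)"
    using wg by (simp add: has_L1_weak_gradient_def)
  show "set_integrable lebesgue \<Omega> (grad f)"
    unfolding set_integrable_def
  proof (rule integrable_cong_AE_imp[OF wi[unfolded set_integrable_def]])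
    show "(\<lambda>x. indicat_real \<Omega> x *\<^sub>R grad f x) \<in> borel_measurable lebesgue"
      by (rule indicator_continuous_measurable[OF assms(1) Ck_on_1_continuous_grad[OF f]])
    show "AE x in lebesgue. indicat_real \<Omega> x *\<^sub>R weak_gradient \<Omega> f x = indicat_real \<Omega> x *\<^sub>R grad f x"
      using 1 by eventually_elim (auto simp: indicator_def)
  qed
qed

lemma W11I_C1:
  fixes f :: "real^'m::finite \<Rightarrow> real"
  assumes "open \<Omega>" and f: "Ck_on 1 \<Omega> f" and "set_integrable lebesgue \<Omega> f" "set_integrable lebesgue \<Omega> (grad f)"
  shows "f \<in> W11 \<Omega>"
proof -
  have "has_L1_weak_gradient \<Omega> f (grad f)"
    unfolding has_L1_weak_gradient_def
    using assms(4) integration_by_parts_test_function(3)[OF assms(1) f] by simp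
  then show ?thesis using assms(3) by (auto simp: W11_def)
qed

lemma set_integrable_bounded_continuous:
  fixes f :: "real^'m::finite \<Rightarrow> 'b::{banach, second_countable_topology}"
  assumes "open \<Omega>" "bounded \<Omega>" "continuous_on \<Omega> f" "\<And>x. x \<in> \<Omega> \<Longrightarrow> norm (f x) \<le> C"
  shows "set_integrable lebesgue \<Omega> f"
proof -
  have lm: "\<Omega> \<in> lmeasurable" by (rule lmeasurable_open[OF assms(2,1)])
  show ?thesis unfolding set_integrable_def
  proof (rule Bochner_Integration.integrable_bound)
    show "integrable lebesgue (\<lambda>x. C * indicator \<Omega> x)"
      using lm by (intro integrable_mult_right) (auto simp: integrable_indicator_iff fmeasurable_def)
    show "(\<lambda>x. indicat_real \<Omega> x *\<^sub>R f x) \<in> borel_measurable lebesgue"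
      by (rule indicator_continuous_measurable[OF assms(1,3)])
    show "AE x in lebesgue. norm (indicat_real \<Omega> x *\<^sub>R f x) \<le> norm (C * indicat_real \<Omega> x)"
    proof (rule AE_I2)
      fix x show "norm (indicat_real \<Omega> x *\<^sub>R f x) \<le> norm (C * indicat_real \<Omega> x)"
        using assms(4)[of x] abs_ge_self[of C] by (cases "x \<in> \<Omega>") (auto intro: order_trans)
    qed
  qed
qed

text \<open>The approximation in \<open>test_function_approx\<close> is uniform for the function and its gradient, which on a
  bounded open set dominates the \<open>W\<^sup>1\<^sup>,\<^sup>1\<close> norm.\<close>

lemma C1_compact_support_in_W11_0:
  fixes \<phi> :: "real^'m::finite \<Rightarrow> real"
  assumes \<Omega>: "open \<Omega>" "bounded \<Omega>" and \<phi>: "Ck_on 1 UNIV \<phi>"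
    and K: "compact K" "K \<subseteq> \<Omega>" and supp: "\<And>x. x \<notin> K \<Longrightarrow> \<phi> x = 0"
  shows "\<phi> \<in> W11 \<Omega>" and "\<phi> \<in> W11_0 \<Omega>"
proof -
  have closedK: "closed K" by (rule compact_imp_closed[OF K(1)])
  have W11: "h \<in> W11 \<Omega>" if h: "Ck_on 1 UNIV h" and b: "\<forall>x. \<bar>h x\<bar> \<le> C" "\<forall>x. norm (grad h x) \<le> D" for h :: "real^'m \<Rightarrow> real" and C D
  proof (rule W11I_C1[OF \<Omega>(1)])
    show h\<Omega>: "Ck_on 1 \<Omega> h" by (rule Ck_on_1_mono[OF h subset_UNIV])
    show "set_integrable lebesgue \<Omega> h"
      by (rule set_integrable_bounded_continuous[OF \<Omega> Ck_on_1D(3)[OF h\<Omega>], of C]) (use b in simp)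
    show "set_integrable lebesgue \<Omega> (grad h)"
      by (rule set_integrable_bounded_continuous[OF \<Omega> Ck_on_1_continuous_grad[OF h\<Omega>], of D]) (use b in simp)
  qed
  obtain C where C: "\<forall>x. \<bar>\<phi> x\<bar> \<le> C"
    using bounded_compact_support[OF Ck_on_1D(3)[OF \<phi>] K(1) supp] by metis
  have g0: "grad \<phi> x = 0" if "x \<notin> K" for x
    using partial_deriv_zero_outside[OF closedK supp that] by (simp add: vec_eq_iff)
  obtain D where D: "\<forall>x. \<bar>norm (grad \<phi> x)\<bar> \<le> D"
    using bounded_compact_support[OF continuous_on_norm[OF Ck_on_1_continuous_grad[OF \<phi>]] K(1)] g0
    by (metis norm_zero)
  show \<phi>W: "\<phi> \<in> W11 \<Omega>"
    by (rule W11[OF \<phi> C]) (use D in simp)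
  have "\<exists>\<psi>. test_function \<Omega> \<psi> \<and> (\<forall>x. \<bar>\<phi> x - \<psi> x\<bar> \<le> 1 / Suc n) \<and>
      (\<forall>i x. \<bar>partial_deriv i \<phi> x - partial_deriv i \<psi> x\<bar> \<le> 1 / Suc n)" for n
    by (rule test_function_approx[OF \<phi> K \<Omega>(1) supp, of "1 / Suc n"]) auto
  then obtain \<psi> where \<psi>: "\<And>n. test_function \<Omega> (\<psi> n)" "\<And>n x. \<bar>\<phi> x - \<psi> n x\<bar> \<le> 1 / Suc n"
    "\<And>n i x. \<bar>partial_deriv i \<phi> x - partial_deriv i (\<psi> n) x\<bar> \<le> 1 / Suc n"
    by metis
  define h where "h n = (\<lambda>x. \<phi> x - \<psi> n x)" for n
  have h1: "Ck_on 1 UNIV (h n)" for n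
    unfolding h_def by (rule Ck_on_1_diff[OF \<phi> test_functionD(1)[OF \<psi>(1)]])
  have hb: "\<bar>h n x\<bar> \<le> 1 / Suc n" for n x using \<psi>(2) by (simp add: h_def)
  have gb: "norm (grad (h n) x) \<le> CARD('m) / Suc n" for n x
  proof -
    have "\<bar>grad (h n) x $ i\<bar> \<le> 1 / Suc n" for i
      using \<psi>(3)[of i x n] Ck_on_1D(1)[OF \<phi>] Ck_on_1D(1)[OF test_functionD(1)[OF \<psi>(1)]]
      by (simp add: h_def partial_deriv_diff)
    then have "(\<Sum>i\<in>UNIV. \<bar>grad (h n) x $ i\<bar>) \<le> (\<Sum>i\<in>(UNIV :: 'm set). 1 / Suc n)"
      by (intro sum_mono)
    then show ?thesis using norm_le_l1_cart[of "grad (h n) x"] by simp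
  qed
  have hW: "h n \<in> W11 \<Omega>" for n
    using W11[OF h1] hb gb by blast
  have lm: "\<Omega> \<in> lmeasurable" by (rule lmeasurable_open[OF \<Omega>(2,1)])
  have int_const: "set_integrable lebesgue \<Omega> (\<lambda>x. c)" "(LINT x:\<Omega>|lebesgue. c) = c * measure lebesgue \<Omega>" for c :: real
    using lm by (auto simp: set_integrable_def set_lebesgue_integral_def fmeasurable_def mult.commute)
  have h\<Omega>: "Ck_on 1 \<Omega> (h n)" for n by (rule Ck_on_1_mono[OF h1 subset_UNIV])
  have bound: "W11_norm \<Omega> (h n) \<le> (1 + CARD('m)) * measure lebesgue \<Omega> / Suc n" for n
  proof -
    note w = W11_C1[OF \<Omega>(1) h\<Omega>[of n] hW[of n]]
    have "(LINT x:\<Omega>|lebesgue. \<bar>h n x\<bar>) \<le> (LINT x:\<Omega>|lebesgue. 1 / Suc n)"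
      by (rule set_integral_mono[OF set_integrable_abs[OF w(3)] int_const(1)]) (rule hb)
    moreover have "(LINT x:\<Omega>|lebesgue. norm (weak_gradient \<Omega> (h n) x)) \<le> (LINT x:\<Omega>|lebesgue. CARD('m) / Suc n)"
    proof (rule set_integral_mono_AE[OF set_integrable_norm[OF w(4)] int_const(1)])
      show "AE x\<in>\<Omega> in lebesgue. norm (weak_gradient \<Omega> (h n) x) \<le> CARD('m) / Suc n"
        using w(1) by eventually_elim (use gb in auto)
    qed
    ultimately have "W11_norm \<Omega> (h n) \<le> (LINT x:\<Omega>|lebesgue. 1 / Suc n) + (LINT x:\<Omega>|lebesgue. CARD('m) / Suc n)"
      unfolding W11_norm_def by linarith
    also have "\<dots> = (1 + CARD('m)) * measure lebesgue \<Omega> / Suc n"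
      unfolding int_const(2) by (simp add: add_divide_distrib distrib_right)
    finally show ?thesis .
  qed
  have nonneg: "0 \<le> W11_norm \<Omega> (h n)" for n
    unfolding W11_norm_def set_lebesgue_integral_def
    by (intro add_nonneg_nonneg Bochner_Integration.integral_nonneg) (simp_all add: indicator_def)
  have "(\<lambda>n. W11_norm \<Omega> (h n)) \<longlonglongrightarrow> 0"
  proof (rule tendsto_sandwich[OF _ _ tendsto_const])
    show "(\<lambda>n. (1 + CARD('m)) * measure lebesgue \<Omega> / Suc n) \<longlonglongrightarrow> 0"
      using LIMSEQ_inverse_real_of_nat[THEN tendsto_mult_left, of "(1 + CARD('m)) * measure lebesgue \<Omega>"]
      by (simp add: divide_inverse)
  qed (use nonneg bound in auto)
  then show "\<phi> \<in> W11_0 \<Omega>"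
    unfolding W11_0_def using \<phi>W \<psi>(1) by (auto simp: h_def)
qed

section \<open>Mixed partial derivatives and exterior derivatives of rank at least three\<close>

lemma has_derivative_along_axis:
  fixes f :: "real^'m::finite \<Rightarrow> real"
  assumes "f differentiable (at (y + s *\<^sub>R axis i 1))"
  shows "((\<lambda>s. f (y + s *\<^sub>R axis i 1)) has_real_derivative partial_deriv i f (y + s *\<^sub>R axis i 1)) (at s)"
proof -
  have "((\<lambda>s. y + s *\<^sub>R axis i (1::real)) has_derivative (\<lambda>h. h *\<^sub>R axis i 1)) (at s)"
    by (auto intro!: derivative_eq_intros)
  then have "((\<lambda>s. f (y + s *\<^sub>R axis i 1)) has_derivative
      (\<lambda>h. grad f (y + s *\<^sub>R axis i 1) \<bullet> (h *\<^sub>R axis i 1))) (at s)"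
    by (rule has_derivative_compose[where g = f]) (rule has_derivative_grad[OF assms])
  then show ?thesis
    by (simp add: has_field_derivative_def inner_axis mult.commute[of _ "partial_deriv _ _ _"])
qed

text \<open>Two applications of the mean value theorem, first in direction \<open>i\<close> and then in direction \<open>j\<close>. The left
  side is symmetric in \<open>i\<close> and \<open>j\<close>, which yields the symmetry of mixed derivatives.\<close>

lemma second_difference_mean_value:
  fixes f :: "real^'m::finite \<Rightarrow> real"
  assumes f: "Ck_on 2 S f" and ball: "ball x r \<subseteq> S" and h: "0 < h" "2 * h < r"
  shows "\<exists>\<xi>. norm (\<xi> - x) < 2 * h \<and>
    f (x + h *\<^sub>R axis i 1 + h *\<^sub>R axis j 1) - f (x + h *\<^sub>R axis i 1) - f (x + h *\<^sub>R axis j 1) + f x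
      = h\<^sup>2 * partial_deriv j (partial_deriv i f) \<xi>"
proof -
  have df: "f differentiable (at y)" if "y \<in> S" for y
    using f that by (simp add: numeral_2_eq_2)
  have dpf: "partial_deriv i f differentiable (at y)" if "y \<in> S" for y
    using f that by (simp add: numeral_2_eq_2)
  have near: "norm (s *\<^sub>R axis i (1::real) + t *\<^sub>R axis j 1 :: real^'m) \<le> \<bar>s\<bar> + \<bar>t\<bar>" for s t
    using norm_triangle_ineq[of "s *\<^sub>R axis i (1::real) :: real^'m" "t *\<^sub>R axis j 1"] by simp
  have inS: "x + s *\<^sub>R axis i 1 + t *\<^sub>R axis j 1 \<in> S" if "0 \<le> s" "s \<le> h" "0 \<le> t" "t \<le> h" for s t
  proof -
    define v :: "real^'m" where "v = s *\<^sub>R axis i 1 + t *\<^sub>R axis j 1"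
    have "norm v < r"
      unfolding v_def using near[of s t] that h by linarith
    then have "x + v \<in> ball x r"
      by (simp add: dist_norm)
    then show ?thesis using ball by (auto simp: v_def add.assoc)
  qed
  define \<phi> where "\<phi> s = f (x + h *\<^sub>R axis j 1 + s *\<^sub>R axis i 1) - f (x + s *\<^sub>R axis i 1)" for s
  define \<phi>' where "\<phi>' s = partial_deriv i f (x + h *\<^sub>R axis j 1 + s *\<^sub>R axis i 1) - partial_deriv i f (x + s *\<^sub>R axis i 1)" for s
  have "(\<phi> has_real_derivative \<phi>' s) (at s)" if "0 \<le> s" "s \<le> h" for s
    unfolding \<phi>_def[abs_def] \<phi>'_def
  proof (rule DERIV_diff; rule has_derivative_along_axis; rule df)
    show "x + h *\<^sub>R axis j 1 + s *\<^sub>R axis i 1 \<in> S"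
      using inS[of s h] that h by (simp add: add.assoc add.commute[of "h *\<^sub>R axis j 1"])
    show "x + s *\<^sub>R axis i 1 \<in> S" using inS[of s 0] that h by simp
  qed
  then obtain s where s: "0 < s" "s < h" "\<phi> h - \<phi> 0 = (h - 0) * \<phi>' s"
    using MVT2[of 0 h \<phi> \<phi>'] h(1) by blast
  define \<psi> where "\<psi> t = partial_deriv i f (x + s *\<^sub>R axis i 1 + t *\<^sub>R axis j 1)" for t
  have "(\<psi> has_real_derivative partial_deriv j (partial_deriv i f) (x + s *\<^sub>R axis i 1 + t *\<^sub>R axis j 1)) (at t)"
    if "0 \<le> t" "t \<le> h" for t
    unfolding \<psi>_def[abs_def]
    by (rule has_derivative_along_axis, rule dpf, rule inS) (use that s in auto)
  then obtain t where t: "0 < t" "t < h"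
    "\<psi> h - \<psi> 0 = (h - 0) * partial_deriv j (partial_deriv i f) (x + s *\<^sub>R axis i 1 + t *\<^sub>R axis j 1)"
    using MVT2[of 0 h \<psi> "\<lambda>t. partial_deriv j (partial_deriv i f) (x + s *\<^sub>R axis i 1 + t *\<^sub>R axis j 1)"] h(1)
    by blast
  have "\<phi>' s = \<psi> h - \<psi> 0"
    by (simp add: \<phi>'_def \<psi>_def add.assoc add.commute[of "h *\<^sub>R axis j 1"])
  with s(3) t(3) have "\<phi> h - \<phi> 0 = h\<^sup>2 * partial_deriv j (partial_deriv i f) (x + s *\<^sub>R axis i 1 + t *\<^sub>R axis j 1)"
    by (simp add: power2_eq_square)
  moreover have "norm (x + s *\<^sub>R axis i 1 + t *\<^sub>R axis j 1 - x) < 2 * h"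
    using near[of s t] s t by (simp add: add.assoc)
  moreover have "\<phi> h - \<phi> 0 = f (x + h *\<^sub>R axis i 1 + h *\<^sub>R axis j 1) - f (x + h *\<^sub>R axis i 1) - f (x + h *\<^sub>R axis j 1) + f x"
    by (simp add: \<phi>_def add.assoc add.commute[of "h *\<^sub>R axis j 1"])
  ultimately show ?thesis by metis
qed

lemma mixed_partials_commute:
  fixes f :: "real^'m::finite \<Rightarrow> real"
  assumes f: "Ck_on 2 S f" and "open S" "x \<in> S"
  shows "partial_deriv i (partial_deriv j f) x = partial_deriv j (partial_deriv i f) x"
proof (rule ccontr)
  let ?A = "partial_deriv i (partial_deriv j f)" and ?B = "partial_deriv j (partial_deriv i f)"
  assume ne: "?A x \<noteq> ?B x"
  define e where "e = \<bar>?A x - ?B x\<bar> / 2"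
  have "e > 0" using ne by (simp add: e_def)
  have cont: "continuous_on S ?A" "continuous_on S ?B"
    using f by (simp_all add: numeral_2_eq_2)
  obtain r where r: "r > 0" "ball x r \<subseteq> S" using assms(2,3) open_contains_ball by blast
  obtain d1 where d1: "d1 > 0" "\<forall>y\<in>S. dist y x < d1 \<longrightarrow> dist (?A y) (?A x) < e"
    using cont(1) assms(3) \<open>e > 0\<close> unfolding continuous_on_iff by blast
  obtain d2 where d2: "d2 > 0" "\<forall>y\<in>S. dist y x < d2 \<longrightarrow> dist (?B y) (?B x) < e"
    using cont(2) assms(3) \<open>e > 0\<close> unfolding continuous_on_iff by blast
  define h where "h = min r (min d1 d2) / 3"
  have h: "0 < h" "2 * h < r" "2 * h < d1" "2 * h < d2"
    using r(1) d1(1) d2(1) by (auto simp: h_def min_def)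
  obtain \<xi> where \<xi>: "norm (\<xi> - x) < 2 * h"
    "f (x + h *\<^sub>R axis i 1 + h *\<^sub>R axis j 1) - f (x + h *\<^sub>R axis i 1) - f (x + h *\<^sub>R axis j 1) + f x = h\<^sup>2 * ?B \<xi>"
    using second_difference_mean_value[OF f r(2) h(1,2), of i j] by blast
  obtain \<eta> where \<eta>: "norm (\<eta> - x) < 2 * h"
    "f (x + h *\<^sub>R axis j 1 + h *\<^sub>R axis i 1) - f (x + h *\<^sub>R axis j 1) - f (x + h *\<^sub>R axis i 1) + f x = h\<^sup>2 * ?A \<eta>"
    using second_difference_mean_value[OF f r(2) h(1,2), of j i] by blast
  have comm: "x + h *\<^sub>R axis j 1 + h *\<^sub>R axis i 1 = x + h *\<^sub>R axis i 1 + h *\<^sub>R axis j 1"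
    by (simp add: add.assoc add.commute[of "h *\<^sub>R axis j 1"])
  have "h\<^sup>2 * ?B \<xi> = h\<^sup>2 * ?A \<eta>"
    using \<xi>(2) \<eta>(2)[unfolded comm] by linarith
  then have eq: "?B \<xi> = ?A \<eta>" using h(1) by simp
  have "\<xi> \<in> S" "\<eta> \<in> S"
    using \<xi>(1) \<eta>(1) h(2) r(2) by (auto simp: subset_iff dist_norm norm_minus_commute)
  then have "dist (?B \<xi>) (?B x) < e" "dist (?A \<eta>) (?A x) < e"
    using d1(2) d2(2) \<xi>(1) \<eta>(1) h(3,4) by (auto simp: dist_norm)
  moreover have False if "\<bar>c - b\<bar> < \<bar>a - b\<bar> / 2" "\<bar>c - a\<bar> < \<bar>a - b\<bar> / 2" for a b c :: real
    using that abs_triangle_ineq4[of "c - b" "c - a"] by auto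
  ultimately show False using eq unfolding e_def dist_real_def by metis
qed

text \<open>The matrix of the two-form \<open>a \<and> b\<close>: each of its rows is a combination of \<open>a\<close> and \<open>b\<close>.\<close>

lemma rank_wedge_le_2:
  fixes a b :: "real^'m::finite"
  shows "rank (\<chi> I J. a $ I * b $ J - a $ J * b $ I) \<le> 2"
proof -
  let ?A = "(\<chi> I J. a $ I * b $ J - a $ J * b $ I) :: real^'m^'m"
  have "row I ?A \<in> span {a, b}" for I
  proof -
    have "row I ?A = a $ I *\<^sub>R b - b $ I *\<^sub>R a"
      by (simp add: row_def vec_eq_iff)
    then show ?thesis by (simp add: span_base span_diff span_scale)
  qed
  then have "rows ?A \<subseteq> span {a, b}" by (auto simp: rows_def)
  then have "dim (rows ?A) \<le> card {a, b}" by (rule dim_le_card) simp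
  also have "\<dots> \<le> 2" by (simp add: card_insert_if)
  finally show ?thesis by (simp add: row_rank_def)
qed

text \<open>Here \<open>h_matrix\<close> is the exterior derivative of a vector field read as a one-form. Near \<open>p\<close> one has
  \<open>\<alpha> = l \<beta>\<close> with \<open>l\<close> differentiable at \<open>p\<close>, so \<open>d\<alpha> = dl \<and> \<beta> + l d\<beta>\<close>. With \<open>d\<alpha> = d\<beta> = h\<close> at \<open>p\<close> this says
  \<open>(1 - l) h = dl \<and> \<beta>\<close>. The right side has rank at most two, and \<open>h\<close> has rank at least three, which
  leaves only \<open>l = 1\<close>.\<close>

lemma parallel_fields_agree:
  fixes \<alpha> \<beta> :: "real^'m::finite \<Rightarrow> real^'m"
  assumes "open U" and p: "p \<in> U"
    and par: "\<And>x. x \<in> U \<Longrightarrow> norm (\<alpha> x) *\<^sub>R \<beta> x = norm (\<beta> x) *\<^sub>R \<alpha> x"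
    and \<alpha>: "\<alpha> differentiable (at p)" and \<beta>: "\<beta> differentiable (at p)" "continuous_on U \<beta>"
    and h: "h_matrix \<alpha> p = h_matrix \<beta> p" "rank (h_matrix \<beta> p) \<ge> 3"
    and ne: "\<beta> p \<noteq> 0"
  shows "\<alpha> p = \<beta> p"
proof -
  define V where "V = {x \<in> U. \<beta> x \<noteq> 0}"
  have "V = U \<inter> \<beta> -` (- {0})" by (auto simp: V_def)
  then have V: "open V" "p \<in> V"
    using continuous_open_preimage[OF \<beta>(2) assms(1), of "- {0}"] p ne by (auto simp: V_def)
  define l where "l x = (\<alpha> x \<bullet> \<beta> x) / (\<beta> x \<bullet> \<beta> x)" for x
  have l: "\<alpha> x = l x *\<^sub>R \<beta> x" if "x \<in> V" for x
  proof -
    have "norm (\<beta> x) \<noteq> 0" using that by (simp add: V_def)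
    moreover have "norm (\<beta> x) *\<^sub>R \<alpha> x = norm (\<alpha> x) *\<^sub>R \<beta> x" using par that by (simp add: V_def)
    ultimately have c: "\<alpha> x = (norm (\<alpha> x) / norm (\<beta> x)) *\<^sub>R \<beta> x"
      by (metis (no_types, lifting) divide_inverse_commute divideR_right scaleR_scaleR)
    then have "\<alpha> x \<bullet> \<beta> x = (norm (\<alpha> x) / norm (\<beta> x)) * (\<beta> x \<bullet> \<beta> x)"
      by (metis inner_scaleR_left)
    then have "l x = norm (\<alpha> x) / norm (\<beta> x)"
      using that by (simp add: l_def V_def)
    with c show ?thesis by simp
  qed
  have dcomp: "(\<lambda>x. G x $ J) differentiable (at p)" if "G differentiable (at p)" for G :: "real^'m \<Rightarrow> real^'m" and J
    using that bounded_linear.has_derivative[OF bounded_linear_vec_nth] unfolding differentiable_def by blast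
  have dl: "l differentiable (at p)"
    unfolding l_def[abs_def] using \<alpha> \<beta>(1) ne
    by (intro differentiable_divide differentiable_inner) auto
  have pd: "partial_deriv I (\<lambda>x. \<alpha> x $ J) p = l p * partial_deriv I (\<lambda>x. \<beta> x $ J) p + partial_deriv I l p * \<beta> p $ J" for I J
  proof -
    have "partial_deriv I (\<lambda>x. \<alpha> x $ J) p = partial_deriv I (\<lambda>x. l x * \<beta> x $ J) p"
    proof (rule partial_deriv_cong_open(2)[OF V])
      show "\<alpha> y $ J = l y * \<beta> y $ J" if "y \<in> V" for y
        using arg_cong[OF l[OF that], of "\<lambda>v. v $ J"] by simp
      show "(\<lambda>x. l x * \<beta> x $ J) differentiable (at p)"
        by (rule differentiable_mult[OF dl dcomp[OF \<beta>(1)]])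
    qed
    then show ?thesis by (simp add: partial_deriv_mult[OF dl dcomp[OF \<beta>(1)]])
  qed
  have "l p = 1"
  proof (rule ccontr)
    assume "l p \<noteq> 1"
    define a where "a = (1 / (1 - l p)) *\<^sub>R grad l p"
    have "h_matrix \<beta> p = (\<chi> I J. a $ I * \<beta> p $ J - a $ J * \<beta> p $ I)"
    proof -
      have "h_matrix \<beta> p $ I $ J = a $ I * \<beta> p $ J - a $ J * \<beta> p $ I" for I J
      proof -
        have "h_matrix \<beta> p $ I $ J = l p * h_matrix \<beta> p $ I $ J + (partial_deriv I l p * \<beta> p $ J - partial_deriv J l p * \<beta> p $ I)"
          using arg_cong[OF h(1), of "\<lambda>M. M $ I $ J"] by (simp add: h_matrix_def pd algebra_simps)
        then have "(1 - l p) * h_matrix \<beta> p $ I $ J = partial_deriv I l p * \<beta> p $ J - partial_deriv J l p * \<beta> p $ I"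
          by (simp add: algebra_simps)
        then have "h_matrix \<beta> p $ I $ J = (partial_deriv I l p * \<beta> p $ J - partial_deriv J l p * \<beta> p $ I) / (1 - l p)"
          using \<open>l p \<noteq> 1\<close> by (simp add: eq_divide_eq mult.commute)
        then show ?thesis by (simp add: a_def diff_divide_distrib)
      qed
      then show ?thesis by (simp add: vec_eq_iff)
    qed
    with h(2) rank_wedge_le_2[of a "\<beta> p"] show False by simp
  qed
  then show ?thesis using l[OF V(2)] by simp
qed

text \<open>A gradient is a closed one-form.\<close>

lemma h_matrix_grad_add:
  fixes F :: "real^'m::finite \<Rightarrow> real^'m" and f :: "real^'m \<Rightarrow> real"
  assumes f: "Ck_on 2 S f" and "open S" "p \<in> S" and F: "F differentiable (at p)"
  shows "h_matrix (\<lambda>x. grad f x + F x) p = h_matrix F p" and "(\<lambda>x. grad f x + F x) differentiable (at p)"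
proof -
  have dF: "(\<lambda>x. F x $ J) differentiable (at p)" for J
    using F bounded_linear.has_derivative[OF bounded_linear_vec_nth] unfolding differentiable_def by blast
  have df: "partial_deriv J f differentiable (at p)" for J
    using f assms(3) by (simp add: numeral_2_eq_2)
  show "h_matrix (\<lambda>x. grad f x + F x) p = h_matrix F p"
    by (simp add: h_matrix_def vec_eq_iff partial_deriv_add[OF df dF] mixed_partials_commute[OF assms(1-3)])
  have "grad f differentiable (at p)"
    using df unfolding differentiable_componentwise_within[of "grad f"]
    by (auto simp: Basis_vec_def inner_axis)
  then show "(\<lambda>x. grad f x + F x) differentiable (at p)"
    using F by (rule differentiable_add)
qed

section \<open>Comparison of minimizers\<close>

lemma set_integrable_mult_L_infty:
  fixes H f :: "real^'m::finite \<Rightarrow> real"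
  assumes "open \<Omega>" and H: "H \<in> L_infty \<Omega>" and f: "set_integrable lebesgue \<Omega> f"
  shows "set_integrable lebesgue \<Omega> (\<lambda>x. H x * f x)"
proof -
  have \<Omega>s: "\<Omega> \<in> sets lebesgue" using assms(1) by simp
  obtain C where C: "AE x in lebesgue_on \<Omega>. \<bar>H x\<bar> \<le> C" and Hm: "H \<in> borel_measurable (lebesgue_on \<Omega>)"
    using H by (auto simp: L_infty_def)
  have C': "AE x in lebesgue. x \<in> \<Omega> \<longrightarrow> \<bar>H x\<bar> \<le> C"
    using C \<Omega>s by (simp add: AE_restrict_space_iff)
  have Hm': "(\<lambda>x. indicator \<Omega> x *\<^sub>R H x) \<in> borel_measurable lebesgue"
    using Hm \<Omega>s by (subst (asm) borel_measurable_restrict_space_iff) simp_all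
  let ?f = "\<lambda>x. indicator \<Omega> x *\<^sub>R f x"
  have fi: "integrable lebesgue ?f" using f by (simp add: set_integrable_def)
  have "integrable lebesgue (\<lambda>x. (indicator \<Omega> x *\<^sub>R H x) * ?f x)"
  proof (rule Bochner_Integration.integrable_bound)
    show "integrable lebesgue (\<lambda>x. C * ?f x)" by (rule integrable_mult_right[OF fi])
    show "(\<lambda>x. (indicator \<Omega> x *\<^sub>R H x) * ?f x) \<in> borel_measurable lebesgue"
      by (rule borel_measurable_times[OF Hm' borel_measurable_integrable[OF fi]])
    show "AE x in lebesgue. norm ((indicator \<Omega> x *\<^sub>R H x) * ?f x) \<le> norm (C * ?f x)"
      using C'
    proof eventually_elim
      case (elim x)
      show ?case
      proof (cases "x \<in> \<Omega>")
        case True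
        then have "\<bar>H x\<bar> \<le> \<bar>C\<bar>" using elim by linarith
        then have "\<bar>H x\<bar> * \<bar>f x\<bar> \<le> \<bar>C\<bar> * \<bar>f x\<bar>" by (rule mult_right_mono) simp
        then show ?thesis using True by (simp add: abs_mult)
      qed simp
    qed
  qed
  moreover have "(\<lambda>x. (indicator \<Omega> x *\<^sub>R H x) * ?f x) = (\<lambda>x. indicator \<Omega> x *\<^sub>R (H x * f x))"
    by (simp add: indicator_def fun_eq_iff)
  ultimately show ?thesis by (simp add: set_integrable_def)
qed

lemma p_area_integrand_integrable:
  fixes F G :: "real^'m::finite \<Rightarrow> real^'m"
  assumes "open \<Omega>" "H \<in> L_infty \<Omega>" "set_integrable lebesgue \<Omega> F"
    "set_integrable lebesgue \<Omega> G" "set_integrable lebesgue \<Omega> f"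
  shows "set_integrable lebesgue \<Omega> (\<lambda>x. norm (G x + F x) + H x * f x)"
  by (intro set_integral_add(1) set_integrable_norm set_integrable_mult_L_infty assms)

lemma p_area_C1:
  fixes F :: "real^'m::finite \<Rightarrow> real^'m"
  assumes "open \<Omega>" "H \<in> L_infty \<Omega>" "set_integrable lebesgue \<Omega> F"
    and f: "Ck_on 1 \<Omega> f" "f \<in> W11 \<Omega>"
  shows "p_area \<Omega> F H f = (LINT x:\<Omega>|lebesgue. norm (grad f x + F x) + H x * f x)"
    and "set_integrable lebesgue \<Omega> (\<lambda>x. norm (grad f x + F x) + H x * f x)"
proof -
  note W = W11_C1[OF assms(1) f]
  show i: "set_integrable lebesgue \<Omega> (\<lambda>x. norm (grad f x + F x) + H x * f x)"
    by (rule p_area_integrand_integrable[OF assms(1-3) W(2,3)])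
  have i': "set_integrable lebesgue \<Omega> (\<lambda>x. norm (weak_gradient \<Omega> f x + F x) + H x * f x)"
    by (rule p_area_integrand_integrable[OF assms(1-3) W(4,3)])
  show "p_area \<Omega> F H f = (LINT x:\<Omega>|lebesgue. norm (grad f x + F x) + H x * f x)"
    unfolding p_area_def set_lebesgue_integral_def
  proof (rule integral_cong_AE)
    show "AE x in lebesgue. indicat_real \<Omega> x *\<^sub>R (norm (weak_gradient \<Omega> f x + F x) + H x * f x) =
        indicat_real \<Omega> x *\<^sub>R (norm (grad f x + F x) + H x * f x)"
      using W(1) by eventually_elim (auto simp: indicator_def)
  qed (use i i' in \<open>simp_all only: set_integrable_def borel_measurable_integrable\<close>)
qed

text \<open>With \<open>s\<close> in the unit interval the two vectors on the left are the convex combinations of \<open>a\<close> and \<open>b\<close> with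
  weights \<open>(1 - s, s)\<close> and \<open>(s, 1 - s)\<close>, so this is the triangle inequality applied twice. For \<open>s\<close> strictly inside the interval, equality
  makes \<open>a\<close> and \<open>b\<close> nonnegative multiples of a common vector.\<close>

lemma convex_combinations_norm:
  fixes a b :: "'a::real_inner"
  assumes s: "0 \<le> s" "s \<le> 1"
  shows "norm (a + s *\<^sub>R (b - a)) + norm (b - s *\<^sub>R (b - a)) \<le> norm a + norm b"
    and "0 < s \<Longrightarrow> s < 1 \<Longrightarrow> norm (a + s *\<^sub>R (b - a)) + norm (b - s *\<^sub>R (b - a)) = norm a + norm b
      \<Longrightarrow> norm a *\<^sub>R b = norm b *\<^sub>R a"
proof -
  have e1: "a + s *\<^sub>R (b - a) = (1 - s) *\<^sub>R a + s *\<^sub>R b"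
    and e2: "b - s *\<^sub>R (b - a) = (1 - s) *\<^sub>R b + s *\<^sub>R a"
    by (simp_all add: algebra_simps)
  have n1: "norm ((1 - s) *\<^sub>R a + s *\<^sub>R b) \<le> (1 - s) * norm a + s * norm b"
    using norm_triangle_ineq[of "(1 - s) *\<^sub>R a" "s *\<^sub>R b"] s by simp
  have n2: "norm ((1 - s) *\<^sub>R b + s *\<^sub>R a) \<le> (1 - s) * norm b + s * norm a"
    using norm_triangle_ineq[of "(1 - s) *\<^sub>R b" "s *\<^sub>R a"] s by simp
  have sum: "((1 - s) * norm a + s * norm b) + ((1 - s) * norm b + s * norm a) = norm a + norm b"
    by (simp add: algebra_simps)
  show "norm (a + s *\<^sub>R (b - a)) + norm (b - s *\<^sub>R (b - a)) \<le> norm a + norm b"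
    unfolding e1 e2 using n1 n2 sum by linarith
  assume s': "0 < s" "s < 1"
    and eq: "norm (a + s *\<^sub>R (b - a)) + norm (b - s *\<^sub>R (b - a)) = norm a + norm b"
  have "norm ((1 - s) *\<^sub>R a + s *\<^sub>R b) = (1 - s) * norm a + s * norm b"
    using eq n1 n2 sum unfolding e1 e2 by linarith
  then have "norm ((1 - s) *\<^sub>R a + s *\<^sub>R b) = norm ((1 - s) *\<^sub>R a) + norm (s *\<^sub>R b)"
    using s by simp
  then have "norm ((1 - s) *\<^sub>R a) *\<^sub>R (s *\<^sub>R b) = norm (s *\<^sub>R b) *\<^sub>R ((1 - s) *\<^sub>R a)"
    by (simp only: norm_triangle_eq)
  then have "((1 - s) * s) *\<^sub>R (norm a *\<^sub>R b) = ((1 - s) * s) *\<^sub>R (norm b *\<^sub>R a)"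
    using s by (simp add: mult.commute mult.left_commute)
  then show "norm a *\<^sub>R b = norm b *\<^sub>R a"
    by (rule scaleR_left_imp_eq[rotated]) (use s' in simp)
qed

text \<open>A continuously differentiable substitute for the positive part.\<close>

definition sqpos :: "real \<Rightarrow> real" where "sqpos t = (max t 0)\<^sup>2"

lemma DERIV_sqpos: "(sqpos has_real_derivative 2 * max t 0) (at t)"
proof -
  consider "t > 0" | "t < 0" | "t = 0" by linarith
  then show ?thesis
  proof cases
    case 1
    have "((\<lambda>t. t\<^sup>2) has_real_derivative 2 * max t 0) (at t)"
      using 1 by (auto intro!: derivative_eq_intros)
    then show ?thesis
      by (rule has_field_derivative_transform_within_open[of _ _ _ "{0<..}"])
         (use 1 in \<open>auto simp: sqpos_def\<close>)
  next
    case 2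
    have "((\<lambda>t. 0) has_real_derivative 2 * max t 0) (at t)" using 2 by simp
    then show ?thesis
      by (rule has_field_derivative_transform_within_open[of _ _ _ "{..<0}"])
         (use 2 in \<open>auto simp: sqpos_def\<close>)
  next
    case 3
    have "(\<lambda>h. (sqpos (0 + h) - sqpos 0) / h) = (\<lambda>h. max h 0)"
      by (auto simp: sqpos_def max_def power2_eq_square)
    moreover have "((\<lambda>h::real. max h 0) \<longlongrightarrow> max 0 0) (at 0)"
      by (intro tendsto_intros)
    ultimately show ?thesis using 3 by (simp add: DERIV_def)
  qed
qed

lemma AE_zero_imp_zero_continuous:
  fixes D :: "real^'m::finite \<Rightarrow> real"
  assumes "open \<Omega>" "continuous_on \<Omega> D" "AE x in lebesgue. x \<in> \<Omega> \<longrightarrow> D x = 0" "x \<in> \<Omega>"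
  shows "D x = 0"
proof -
  let ?N = "\<Omega> \<inter> D -` (- {0})"
  have "open ?N"
    by (rule continuous_open_preimage[OF assms(2,1)]) (simp add: open_Compl)
  then have cl: "closed (- ?N)" by (rule closed_Compl)
  have ae: "AE x\<in>\<Omega> in lebesgue. x \<in> - ?N"
    using assms(3) by eventually_elim simp
  have "x \<in> - ?N" by (rule mem_closed_if_AE_lebesgue_open[OF assms(1) cl ae assms(4)])
  then show ?thesis using assms(4) by simp
qed

text \<open>Move \<open>u\<close> up and \<open>v\<close> down by the same function \<open>\<phi>\<close>, equal to \<open>c (max (w - \<epsilon>) 0)\<^sup>2\<close> with \<open>w = v - u\<close>. Its
  gradient is \<open>s\<close> times the gradient of \<open>w\<close> for a function \<open>s\<close> with values between \<open>0\<close> and \<open>1/2\<close>, so each of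
  the two new integrands contains a convex combination of \<open>\<alpha>\<close> and \<open>\<beta>\<close>. Adding the two minimality
  inequalities cancels the terms with \<open>H\<close>, and \<open>convex_combinations_norm\<close> leaves a nonnegative
  continuous integrand \<open>D\<close> with integral at most zero. Subtracting \<open>\<epsilon>\<close> makes the support of \<open>\<phi>\<close> a compact
  subset of \<open>\<Omega>\<close>, so that \<open>\<phi>\<close> is an admissible variation whatever the boundary looks like.\<close>

lemma minimizers_parallel:
  fixes F :: "real^'m::finite \<Rightarrow> real^'m" and u v H :: "real^'m \<Rightarrow> real"
  assumes \<Omega>: "open \<Omega>" "bounded \<Omega>"
    and F: "continuous_on (closure \<Omega>) F" and H: "H \<in> L_infty \<Omega>"
    and u: "Ck_on 1 \<Omega> u" "continuous_on (closure \<Omega>) u" "p_area_minimizer \<Omega> F H u"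
    and v: "Ck_on 1 \<Omega> v" "continuous_on (closure \<Omega>) v" "p_area_minimizer \<Omega> F H v"
    and bdry: "\<And>x. x \<in> frontier \<Omega> \<Longrightarrow> u x = v x"
    and x: "x0 \<in> \<Omega>" "u x0 < v x0"
  shows "norm (grad u x0 + F x0) *\<^sub>R (grad v x0 + F x0) = norm (grad v x0 + F x0) *\<^sub>R (grad u x0 + F x0)"
proof -
  define w where "w x = v x - u x" for x
  define \<epsilon> where "\<epsilon> = w x0 / 2"
  have \<epsilon>: "\<epsilon> > 0" "w x0 > \<epsilon>" using x(2) by (simp_all add: \<epsilon>_def w_def)
  have ccl: "compact (closure \<Omega>)" using \<Omega>(2) by (simp add: compact_closure)
  have w: "Ck_on 1 \<Omega> w" "continuous_on (closure \<Omega>) w"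
    unfolding w_def[abs_def] by (rule Ck_on_1_diff[OF v(1) u(1)], rule continuous_on_diff[OF v(2) u(2)])
  have gw: "grad w x = grad v x - grad u x" if "x \<in> \<Omega>" for x
    unfolding w_def[abs_def] using that
    by (simp add: vec_eq_iff partial_deriv_diff Ck_on_1D(1)[OF u(1)] Ck_on_1D(1)[OF v(1)])
  obtain M where M: "\<forall>y\<in>w ` closure \<Omega>. norm y \<le> M"
    using compact_imp_bounded[OF compact_continuous_image[OF w(2) ccl]] unfolding bounded_iff by blast
  have wM: "\<bar>w x\<bar> \<le> M" if "x \<in> \<Omega>" for x
    using M closure_subset that by (metis imageI real_norm_def subsetD)
  have "M \<ge> 0" using wM[OF x(1)] by linarith
  \<comment> \<open>Chosen such that the factor \<open>s\<close> stays at or below \<open>1/2\<close>, in particular below \<open>1\<close>, where strict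
    convexity is available.\<close>
  define c where "c = 1 / (4 * (M + 1))"
  have c: "c > 0" using \<open>M \<ge> 0\<close> by (simp add: c_def)
  define s where "s x = c * (2 * max (w x - \<epsilon>) 0)" for x
  have s: "0 \<le> s x" "s x \<le> 1 / 2" if "x \<in> \<Omega>" for x
  proof -
    show "0 \<le> s x" using c by (simp add: s_def)
    have "max (w x - \<epsilon>) 0 \<le> M + 1" using wM[OF that] \<epsilon>(1) by auto
    then have "s x \<le> c * (2 * (M + 1))"
      unfolding s_def using c by (intro mult_left_mono) simp_all
    also have "\<dots> = 1 / 2" using \<open>M \<ge> 0\<close> by (simp add: c_def)
    finally show "s x \<le> 1 / 2" .
  qed
  define \<phi>0 where "\<phi>0 x = c * sqpos (w x - \<epsilon>)" for x
  have D\<phi>0: "((\<lambda>t. c * sqpos (t - \<epsilon>)) has_real_derivative c * (2 * max (t - \<epsilon>) 0)) (at t)" for t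
  proof -
    have "((\<lambda>t. t - \<epsilon>) has_real_derivative 1) (at t)"
      by (auto intro!: derivative_eq_intros)
    from DERIV_chain2[OF DERIV_sqpos this]
    have "((\<lambda>t. sqpos (t - \<epsilon>)) has_real_derivative 2 * max (t - \<epsilon>) 0) (at t)" by simp
    then show ?thesis by (rule DERIV_cmult)
  qed
  have pd\<phi>0: "partial_deriv i \<phi>0 x = s x * partial_deriv i w x" and d\<phi>0: "\<phi>0 differentiable (at x)" if "x \<in> \<Omega>" for x i
  proof -
    show "partial_deriv i \<phi>0 x = s x * partial_deriv i w x"
      unfolding \<phi>0_def[abs_def] s_def by (rule partial_deriv_compose[OF Ck_on_1D(1)[OF w(1) that] D\<phi>0])
    show "\<phi>0 differentiable (at x)"
      using has_derivative_field_compose[OF has_derivative_grad[OF Ck_on_1D(1)[OF w(1) that]] D\<phi>0]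
      unfolding \<phi>0_def[abs_def] differentiable_def by blast
  qed
  have cw: "continuous_on \<Omega> w" by (rule Ck_on_1D(3)[OF w(1)])
  have cs: "continuous_on \<Omega> s"
    unfolding s_def[abs_def] by (intro continuous_intros cw)
  have \<phi>0C1: "Ck_on 1 \<Omega> \<phi>0"
  proof -
    have "continuous_on \<Omega> (partial_deriv i \<phi>0)" for i
      by (subst continuous_on_cong[OF refl pd\<phi>0]) (auto intro!: continuous_on_mult cs Ck_on_1D(2)[OF w(1)])
    then show ?thesis unfolding Ck_on_1_iff using d\<phi>0 by blast
  qed
  define K where "K = closure \<Omega> \<inter> w -` {\<epsilon>..}"
  have "closed K"
    unfolding K_def by (rule continuous_closed_preimage[OF w(2)]) simp_all
  then have K: "compact K"
    using compact_Int_closed[OF ccl] by (metis K_def inf.left_idem)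
  \<comment> \<open>On the frontier \<open>w\<close> vanishes and is therefore below \<open>\<epsilon>\<close>.\<close>
  have K\<Omega>: "K \<subseteq> \<Omega>"
  proof
    fix y assume y: "y \<in> K"
    have "y \<notin> frontier \<Omega>" using y \<epsilon>(1) bdry[of y] by (auto simp: K_def w_def)
    then show "y \<in> \<Omega>" using y \<Omega>(1) by (simp add: K_def frontier_def interior_open)
  qed
  have \<phi>0K: "\<phi>0 x = 0" if "x \<in> \<Omega>" "x \<notin> K" for x
  proof -
    have "w x < \<epsilon>" using that closure_subset[of \<Omega>] by (auto simp: K_def)
    then show ?thesis by (simp add: \<phi>0_def sqpos_def)
  qed
  define \<phi> where "\<phi> x = (if x \<in> \<Omega> then \<phi>0 x else 0)" for x
  have \<phi>C1: "Ck_on 1 UNIV \<phi>"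
    unfolding \<phi>_def[abs_def] by (rule Ck_on_1_zero_extension(1)[OF \<Omega>(1) \<open>closed K\<close> K\<Omega> \<phi>0C1 \<phi>0K])
  have pd\<phi>: "partial_deriv i \<phi> x = s x * partial_deriv i w x" if "x \<in> \<Omega>" for x i
    using Ck_on_1_zero_extension(2)[OF \<Omega>(1) \<open>closed K\<close> K\<Omega> \<phi>0C1 \<phi>0K, of i x] that
    by (simp add: \<phi>_def[abs_def] pd\<phi>0)
  have \<phi>K: "\<phi> x = 0" if "x \<notin> K" for x using \<phi>0K that by (simp add: \<phi>_def)
  have n\<phi>C1: "Ck_on 1 UNIV (\<lambda>x. 0 - \<phi> x)"
    by (rule Ck_on_1_diff[OF _ \<phi>C1]) (simp add: Ck_on_1_iff)
  have n\<phi>K: "0 - \<phi> x = 0" if "x \<notin> K" for x using \<phi>K[OF that] by simp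
  have \<phi>W: "\<phi> \<in> W11 \<Omega>" "\<phi> \<in> W11_0 \<Omega>"
    using C1_compact_support_in_W11_0[OF \<Omega> \<phi>C1 K K\<Omega>] \<phi>K by blast+
  have n\<phi>W: "(\<lambda>x. 0 - \<phi> x) \<in> W11 \<Omega>" "(\<lambda>x. 0 - \<phi> x) \<in> W11_0 \<Omega>"
    using C1_compact_support_in_W11_0[OF \<Omega> n\<phi>C1 K K\<Omega>] n\<phi>K by blast+

  have FC: "set_integrable lebesgue \<Omega> F"
  proof -
    obtain B where B: "\<forall>y\<in>F ` closure \<Omega>. norm y \<le> B"
      using compact_imp_bounded[OF compact_continuous_image[OF F ccl]] unfolding bounded_iff by blast
    show ?thesis
      by (rule set_integrable_bounded_continuous[OF \<Omega> continuous_on_subset[OF F closure_subset], of B])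
         (use B closure_subset[of \<Omega>] in blast)
  qed
  have add: "Ck_on 1 \<Omega> (\<lambda>x. f x + g x) \<and> (\<lambda>x. f x + g x) \<in> W11 \<Omega>"
    if f: "Ck_on 1 \<Omega> f" "f \<in> W11 \<Omega>" and g: "Ck_on 1 UNIV g" "g \<in> W11 \<Omega>" for f g
  proof -
    have g1: "Ck_on 1 \<Omega> g" by (rule Ck_on_1_mono[OF g(1) subset_UNIV])
    note wf = W11_C1[OF \<Omega>(1) f] and wg = W11_C1[OF \<Omega>(1) g1 g(2)]
    have fg: "Ck_on 1 \<Omega> (\<lambda>x. f x + g x)" by (rule Ck_on_1_add[OF f(1) g1])
    have "set_integrable lebesgue \<Omega> (\<lambda>x. grad f x + grad g x)"
      by (rule set_integral_add(1)[OF wf(2) wg(2)])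
    then have "set_integrable lebesgue \<Omega> (grad (\<lambda>x. f x + g x))"
      by (rule set_integrable_cong[THEN iffD1, OF refl refl, rotated])
         (simp add: vec_eq_iff partial_deriv_add Ck_on_1D(1)[OF f(1)] Ck_on_1D(1)[OF g1])
    then show ?thesis
      using fg W11I_C1[OF \<Omega>(1) fg set_integral_add(1)[OF wf(3) wg(3)]] by blast
  qed
  have uW: "u \<in> W11 \<Omega>" and vW: "v \<in> W11 \<Omega>" using u(3) v(3) by (simp_all add: p_area_minimizer_def)
  define \<alpha> where "\<alpha> x = grad u x + F x" for x
  define \<beta> where "\<beta> x = grad v x + F x" for x
  have \<beta>\<alpha>: "grad w x = \<beta> x - \<alpha> x" if "x \<in> \<Omega>" for x by (simp add: gw[OF that] \<alpha>_def \<beta>_def)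
  note u\<phi> = add[OF u(1) uW \<phi>C1 \<phi>W(1)] and v\<phi> = add[OF v(1) vW n\<phi>C1 n\<phi>W(1)]
  have gu\<phi>: "grad (\<lambda>x. u x + \<phi> x) x + F x = \<alpha> x + s x *\<^sub>R (\<beta> x - \<alpha> x)" if "x \<in> \<Omega>" for x
    using that \<beta>\<alpha>[OF that, symmetric]
    by (simp add: vec_eq_iff \<alpha>_def pd\<phi> partial_deriv_add Ck_on_1D(1)[OF u(1)] Ck_on_1D(1)[OF \<phi>C1])
  have gv\<phi>: "grad (\<lambda>x. v x + (0 - \<phi> x)) x + F x = \<beta> x - s x *\<^sub>R (\<beta> x - \<alpha> x)" if "x \<in> \<Omega>" for x
    using that \<beta>\<alpha>[OF that, symmetric] partial_deriv_diff[of "\<lambda>_. 0" x \<phi>]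
    by (simp only: vec_eq_iff vector_add_component grad_nth \<beta>_def pd\<phi> partial_deriv_add[OF Ck_on_1D(1)[OF v(1)] Ck_on_1D(1)[OF n\<phi>C1 UNIV_I]])
       (simp add: Ck_on_1D(1)[OF \<phi>C1] pd\<phi>)
  note Pu = p_area_C1[OF \<Omega>(1) H FC u(1) uW] and Pv = p_area_C1[OF \<Omega>(1) H FC v(1) vW]
    and Pu\<phi> = p_area_C1[OF \<Omega>(1) H FC conjunct1[OF u\<phi>] conjunct2[OF u\<phi>]]
    and Pv\<phi> = p_area_C1[OF \<Omega>(1) H FC conjunct1[OF v\<phi>] conjunct2[OF v\<phi>]]
  have le1: "p_area \<Omega> F H u \<le> p_area \<Omega> F H (\<lambda>x. u x + \<phi> x)"
    by (rule bspec[OF conjunct2[OF u(3)[unfolded p_area_minimizer_def]] \<phi>W(2)])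
  have le2: "p_area \<Omega> F H v \<le> p_area \<Omega> F H (\<lambda>x. v x + (0 - \<phi> x))"
    by (rule bspec[OF conjunct2[OF v(3)[unfolded p_area_minimizer_def]] n\<phi>W(2)])
  define D where "D x = norm (\<alpha> x) + norm (\<beta> x) - norm (\<alpha> x + s x *\<^sub>R (\<beta> x - \<alpha> x)) - norm (\<beta> x - s x *\<^sub>R (\<beta> x - \<alpha> x))" for x
  \<comment> \<open>The integrands of the four areas, in the order \<open>u\<close>, \<open>v\<close>, \<open>u + \<phi>\<close>, \<open>v - \<phi>\<close>.\<close>
  define a1 where "a1 x = norm (grad u x + F x) + H x * u x" for x
  define a2 where "a2 x = norm (grad v x + F x) + H x * v x" for x
  define b1 where "b1 x = norm (grad (\<lambda>x. u x + \<phi> x) x + F x) + H x * (u x + \<phi> x)" for x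
  define b2 where "b2 x = norm (grad (\<lambda>x. v x + (0 - \<phi> x)) x + F x) + H x * (v x + (0 - \<phi> x))" for x
  note int = Pu(2)[folded a1_def] Pv(2)[folded a2_def] Pu\<phi>(2)[folded b1_def] Pv\<phi>(2)[folded b2_def]
  note area = Pu(1)[folded a1_def] Pv(1)[folded a2_def] Pu\<phi>(1)[folded b1_def] Pv\<phi>(1)[folded b2_def]
  have intD0: "set_integrable lebesgue \<Omega> (\<lambda>x. (a1 x + a2 x) - (b1 x + b2 x))"
    by (intro set_integral_diff(1) set_integral_add(1) int)
  have "(LINT x:\<Omega>|lebesgue. (a1 x + a2 x) - (b1 x + b2 x)) =
      (LINT x:\<Omega>|lebesgue. a1 x + a2 x) - (LINT x:\<Omega>|lebesgue. b1 x + b2 x)"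
    by (rule set_integral_diff(2)) (intro set_integral_add(1) int)+
  moreover have "(LINT x:\<Omega>|lebesgue. a1 x + a2 x) = p_area \<Omega> F H u + p_area \<Omega> F H v"
    unfolding area by (rule set_integral_add(2)[OF int(1,2)])
  moreover have "(LINT x:\<Omega>|lebesgue. b1 x + b2 x) =
      p_area \<Omega> F H (\<lambda>x. u x + \<phi> x) + p_area \<Omega> F H (\<lambda>x. v x + (0 - \<phi> x))"
    unfolding area by (rule set_integral_add(2)[OF int(3,4)])
  ultimately have le: "(LINT x:\<Omega>|lebesgue. (a1 x + a2 x) - (b1 x + b2 x)) \<le> 0"
    using le1 le2 by linarith
  have DD: "(a1 x + a2 x) - (b1 x + b2 x) = D x" if "x \<in> \<Omega>" for x
    unfolding a1_def a2_def b1_def b2_def gu\<phi>[OF that] gv\<phi>[OF that] D_def \<alpha>_def[symmetric] \<beta>_def[symmetric]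
    by (simp add: algebra_simps)
  have ind: "(\<lambda>x. indicator \<Omega> x *\<^sub>R ((a1 x + a2 x) - (b1 x + b2 x))) = (\<lambda>x. indicator \<Omega> x *\<^sub>R D x)"
  proof
    fix x show "indicator \<Omega> x *\<^sub>R ((a1 x + a2 x) - (b1 x + b2 x)) = indicator \<Omega> x *\<^sub>R D x"
    proof (cases "x \<in> \<Omega>")
      case True
      then show ?thesis by (simp only: DD)
    qed simp
  qed
  have intD: "(LINT x|lebesgue. indicator \<Omega> x *\<^sub>R D x) \<le> 0"
    using le unfolding set_lebesgue_integral_def ind .
  have i2: "integrable lebesgue (\<lambda>x. indicator \<Omega> x *\<^sub>R D x)"
    using intD0 unfolding set_integrable_def ind .
  have Dnn: "0 \<le> D x" if "x \<in> \<Omega>" for x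
    using convex_combinations_norm(1)[of "s x" "\<alpha> x" "\<beta> x"] s[OF that] by (simp add: D_def)
  then have nn: "0 \<le> indicator \<Omega> x *\<^sub>R D x" for x by (simp add: indicator_def)
  have "0 \<le> (LINT x|lebesgue. indicator \<Omega> x *\<^sub>R D x)"
    by (rule Bochner_Integration.integral_nonneg) (rule nn)
  with intD have "(LINT x|lebesgue. indicator \<Omega> x *\<^sub>R D x) = 0"
    by linarith
  then have "AE x in lebesgue. indicator \<Omega> x *\<^sub>R D x = 0"
    by (subst (asm) integral_nonneg_eq_0_iff_AE[OF i2]) (use nn in simp_all)
  then have AED: "AE x in lebesgue. x \<in> \<Omega> \<longrightarrow> D x = 0"
    by eventually_elim (auto simp: indicator_def)
  have c\<alpha>: "continuous_on \<Omega> \<alpha>" "continuous_on \<Omega> \<beta>"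
    unfolding \<alpha>_def[abs_def] \<beta>_def[abs_def]
    by (intro continuous_on_add Ck_on_1_continuous_grad u(1) v(1) continuous_on_subset[OF F closure_subset])+
  have "continuous_on \<Omega> D"
    unfolding D_def[abs_def] by (intro continuous_intros c\<alpha> cs)
  then have "D x0 = 0" by (rule AE_zero_imp_zero_continuous[OF \<Omega>(1) _ AED x(1)])
  then have eq: "norm (\<alpha> x0 + s x0 *\<^sub>R (\<beta> x0 - \<alpha> x0)) + norm (\<beta> x0 - s x0 *\<^sub>R (\<beta> x0 - \<alpha> x0)) = norm (\<alpha> x0) + norm (\<beta> x0)"
    by (simp add: D_def)
  have "0 < s x0" using \<epsilon>(2) c by (simp add: s_def)
  moreover have "s x0 < 1" using s(2)[OF x(1)] by simp
  ultimately have "norm (\<alpha> x0) *\<^sub>R \<beta> x0 = norm (\<beta> x0) *\<^sub>R \<alpha> x0"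
    using convex_combinations_norm(2)[of "s x0" "\<alpha> x0" "\<beta> x0"] eq by simp
  then show ?thesis by (simp add: \<alpha>_def \<beta>_def)
qed

text \<open>On the open set \<open>U\<close> where \<open>w = v - u\<close> is positive the fields \<open>\<alpha>\<close> and \<open>\<beta>\<close> are parallel with equal exterior
  derivatives of rank at least three, so they agree and the gradient of \<open>w\<close> vanishes there. Passing to
  \<open>sqpos (w x)\<close>, whose derivative vanishes on all of \<open>\<Omega>\<close>, avoids any discussion of the shape of \<open>U\<close>: this
  function is constant, and zero at the boundary.\<close>

lemma minimizers_ordered:
  fixes F :: "real^'m::finite \<Rightarrow> real^'m" and u v H :: "real^'m \<Rightarrow> real"
  assumes \<Omega>: "open \<Omega>" "connected \<Omega>" "\<Omega> \<noteq> {}" "bounded \<Omega>"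
    and F: "C1_closure \<Omega> F" and H: "H \<in> L_infty \<Omega>"
    and u: "Ck_on 2 \<Omega> u" "continuous_on (closure \<Omega>) u" "p_area_minimizer \<Omega> F H u"
    and v: "Ck_on 2 \<Omega> v" "continuous_on (closure \<Omega>) v" "p_area_minimizer \<Omega> F H v"
    and bdry: "\<And>x. x \<in> frontier \<Omega> \<Longrightarrow> u x = v x"
    and rank: "\<And>p. p \<in> \<Omega> \<Longrightarrow> rank (h_matrix F p) \<ge> 3"
    and x: "x \<in> \<Omega>"
  shows "v x \<le> u x"
proof -
  define w where "w x = v x - u x" for x
  note u1 = Ck_on_2_imp_1[OF u(1)] and v1 = Ck_on_2_imp_1[OF v(1)]
  have FC: "continuous_on (closure \<Omega>) F" and FC1: "Ck_on 1 \<Omega> F" using F by (simp_all add: C1_closure_def)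
  have w: "Ck_on 1 \<Omega> w" "continuous_on (closure \<Omega>) w"
    unfolding w_def[abs_def] by (rule Ck_on_1_diff[OF v1 u1], rule continuous_on_diff[OF v(2) u(2)])
  define U where "U = \<Omega> \<inter> w -` {0<..}"
  have U: "open U"
    unfolding U_def by (rule continuous_open_preimage[OF Ck_on_1D(3)[OF w(1)] \<Omega>(1)]) simp
  define \<alpha> where "\<alpha> = (\<lambda>x. grad u x + F x)"
  define \<beta> where "\<beta> = (\<lambda>x. grad v x + F x)"
  have par: "norm (\<alpha> x) *\<^sub>R \<beta> x = norm (\<beta> x) *\<^sub>R \<alpha> x" if "x \<in> U" for x
    using minimizers_parallel[OF \<Omega>(1,4) FC H u1 u(2,3) v1 v(2,3) bdry, of x] that
    by (simp add: U_def w_def \<alpha>_def \<beta>_def)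
  have US: "U \<subseteq> \<Omega>" by (simp add: U_def)
  have "continuous_on \<Omega> \<alpha>" "continuous_on \<Omega> \<beta>"
    unfolding \<alpha>_def \<beta>_def
    by (intro continuous_on_add Ck_on_1_continuous_grad u1 v1 Ck_on_1D(3)[OF FC1])+
  then have cont: "continuous_on U \<alpha>" "continuous_on U \<beta>"
    using US continuous_on_subset by blast+
  have agree: "\<alpha> p = \<beta> p" if p: "p \<in> U" for p
  proof -
    have p\<Omega>: "p \<in> \<Omega>" using p US by blast
    note Fd = Ck_on_1D(1)[OF FC1 p\<Omega>]
    note a = h_matrix_grad_add[OF u(1) \<Omega>(1) p\<Omega> Fd, folded \<alpha>_def]
      and b = h_matrix_grad_add[OF v(1) \<Omega>(1) p\<Omega> Fd, folded \<beta>_def]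
    show ?thesis
    proof (cases "\<beta> p = 0")
      case False
      show ?thesis
        by (rule parallel_fields_agree[OF U p par a(2) b(2) cont(2)]) (use a(1) b(1) rank[OF p\<Omega>] False in simp_all)
    next
      case True
      show ?thesis
      proof (cases "\<alpha> p = 0")
        case False
        \<comment> \<open>The roles of \<open>\<alpha>\<close> and \<open>\<beta>\<close> are exchanged, because only \<open>\<alpha>\<close> can serve as the divisor.\<close>
        have "\<beta> p = \<alpha> p"
          by (rule parallel_fields_agree[OF U p par[symmetric] b(2) a(2) cont(1)]) (use a(1) b(1) rank[OF p\<Omega>] False in simp_all)
        then show ?thesis by simp
      qed (simp add: True)
    qed
  qed
  have gw: "grad w p = 0" if p: "p \<in> U" for p
  proof -
    have "grad u p = grad v p" using agree[OF p] by (simp add: \<alpha>_def \<beta>_def)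
    then show ?thesis
      using US p Ck_on_1D(1)[OF u1] Ck_on_1D(1)[OF v1]
      by (simp add: w_def[abs_def] vec_eq_iff partial_deriv_diff subset_iff)
  qed
  have cont_sq: "continuous_on (closure \<Omega>) (\<lambda>x. sqpos (w x))"
    unfolding sqpos_def by (intro continuous_intros w(2))
  have "((\<lambda>x. sqpos (w x)) has_derivative (\<lambda>h. 0)) (at x within \<Omega>)" if "x \<in> \<Omega>" for x
  proof -
    have "((\<lambda>x. sqpos (w x)) has_derivative (\<lambda>h. (2 * max (w x) 0) * (grad w x \<bullet> h))) (at x)"
      by (rule has_derivative_field_compose[OF has_derivative_grad[OF Ck_on_1D(1)[OF w(1) that]] DERIV_sqpos])
    moreover have "(\<lambda>h. (2 * max (w x) 0) * (grad w x \<bullet> h)) = (\<lambda>h. 0)"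
    proof (cases "w x > 0")
      case True
      then show ?thesis using gw[of x] that by (simp add: U_def)
    qed simp
    ultimately show ?thesis by (simp add: has_derivative_at_withinI)
  qed
  then have "(\<lambda>x. sqpos (w x)) constant_on \<Omega>"
    using has_derivative_zero_connected_constant_on[OF \<Omega>(2,1) finite.emptyI continuous_on_subset[OF cont_sq closure_subset]]
    by blast
  then obtain k where k: "\<And>x. x \<in> \<Omega> \<Longrightarrow> sqpos (w x) = k" unfolding constant_on_def by blast
  have "frontier \<Omega> \<noteq> {}"
    using \<Omega>(3,4) not_bounded_UNIV frontier_eq_empty by blast
  then obtain y where y: "y \<in> frontier \<Omega>" by blast
  have ycl: "y \<in> closure \<Omega>" using y by (simp add: frontier_def)
  have "sqpos (w y) = k"
    by (rule continuous_constant_on_closure[OF cont_sq _ ycl]) (rule k)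
  moreover have "sqpos (w y) = 0" using bdry[OF y] by (simp add: w_def sqpos_def)
  ultimately have "sqpos (w x) = 0" using k[OF x] by simp
  then show ?thesis by (simp add: sqpos_def w_def max_def split: if_splits)
qed

theorem corollaryA1:
  fixes \<Omega> :: "(real^'m) set"
    and F :: "real^'m \<Rightarrow> real^'m"
    and H u v :: "real^'m \<Rightarrow> real"
  assumes "open \<Omega>" and "connected \<Omega>" and "\<Omega> \<noteq> {}" and "bounded \<Omega>"
    and "C1_closure \<Omega> F"
    and "H \<in> L_infty \<Omega>"
    and "Ck_on 2 \<Omega> u" and "continuous_on (closure \<Omega>) u" and "u \<in> W11 \<Omega>"
    and "Ck_on 2 \<Omega> v" and "continuous_on (closure \<Omega>) v" and "v \<in> W11 \<Omega>"
    and "p_area_minimizer \<Omega> F H u" and "p_area_minimizer \<Omega> F H v"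
    and "\<forall>x\<in>frontier \<Omega>. u x = v x"
    and "\<forall>p\<in>\<Omega>. CARD('m) \<ge> rank (h_matrix F p) \<and> rank (h_matrix F p) \<ge> 3"
  shows "\<forall>x\<in>\<Omega>. u x = v x"
proof
  fix x assume x: "x \<in> \<Omega>"
  have "v x \<le> u x"
    by (rule minimizers_ordered[OF assms(1-6) assms(7,8,13) assms(10,11,14) _ _ x]) (use assms(15,16) in auto)
  moreover have "u x \<le> v x"
    by (rule minimizers_ordered[OF assms(1-6) assms(10,11,14) assms(7,8,13) _ _ x]) (use assms(15,16) in auto)
  ultimately show "u x = v x" by simp
qed

end
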